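(* Let $D=\prod_{i\in I}D_i$ be a product of topological Abelian groups and let $G$ be a subgroup of $PD$ with $\Sigma D\subset G\subset PD$, equipped with the topology inherited from $PD$. Then $G$ is reflexive if and only if, for every set $J\subset I$ satisfying $|J|\le\aleph_1$, the subgroup $\pi_J(G)$ of $PD_J$ is reflexive, where $D_J=\prod_{i\in J}D_i$ and $\pi_J:D\to D_J$ is the projection.
   Context: Topological groups are assumed Hausdorff. $\mathbb T=\{z\in\mathbb C:|z|=1\}$ is the circle group. For a topological Abelian group $G$, $G^\wedge$ is the group of continuous characters (continuous homomorphisms $G\to\mathbb T$) with the topology of uniform convergence on compact subsets of $G$. $G$ is reflexive if the evaluation homomorphism $\alpha_G:G\to G^{\wedge\wedge}$, $\alpha_G(x)(\chi)=\chi(x)$, is a topological isomorphism of $G$ onto $G^{\wedge\wedge}=(G^\wedge)^\wedge$. For a topological group $H$, $PH$ ($P$-modification) is the same group with the finer group topology whose base consists of all $G_\delta$-sets of $H$. Products carry the Tychonoff product topology; $PD$ and $PD_J$ are the $P$-modifications of the product groups $D$ and $D_J$. For $x\in D$, $\operatorname{supp}(x)=\{i\in I: x(i)\ne 0_i\}$, where $0_i$ is the neutral element of $D_i$; $\Sigma D=\{x\in D: |\operatorname{supp}(x)|\le\omega\}$. *)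

theory Defs
  imports "HOL-Analysis.Analysis" "HOL-Algebra.Product_Groups"
begin

unbundle cardinal_syntax

text \<open>A topological group is given by an algebraic group together with a topology on its carrier.\<close>

definition topological_abelian_group :: "('a, 'm) monoid_scheme \<Rightarrow> 'a topology \<Rightarrow> bool" where
  "topological_abelian_group G T \<longleftrightarrow>
     comm_group G \<and> topspace T = carrier G \<and> Hausdorff_space T \<and>
     continuous_map (prod_topology T T) T (\<lambda>(x, y). x \<otimes>\<^bsub>G\<^esub> y) \<and>
     continuous_map T T (\<lambda>x. inv\<^bsub>G\<^esub> x)"

definition circle_group :: "complex monoid" where
  "circle_group = \<lparr>carrier = sphere 0 1, monoid.mult = (*), one = 1\<rparr>"

text \<open>Characters are taken extensional, so that equality in HOL is equality on the group.\<close>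

definition characters :: "('a, 'm) monoid_scheme \<Rightarrow> 'a topology \<Rightarrow> ('a \<Rightarrow> complex) set" where
  "characters G T =
     {\<phi> \<in> extensional (carrier G).
        \<phi> \<in> hom G circle_group \<and> continuous_map T (top_of_set (sphere 0 1)) \<phi>}"

definition dual_group :: "('a, 'm) monoid_scheme \<Rightarrow> 'a topology \<Rightarrow> ('a \<Rightarrow> complex) monoid" where
  "dual_group G T =
     \<lparr>carrier = characters G T,
      monoid.mult = (\<lambda>\<phi> \<psi>. \<lambda>x\<in>carrier G. \<phi> x * \<psi> x),
      one = (\<lambda>x\<in>carrier G. 1)\<rparr>"

text \<open>The topology of uniform convergence on compact subsets. A single compact set
  suffices in the neighbourhood condition since finite unions of compact sets are compact.\<close>

definition dual_topology :: "('a, 'm) monoid_scheme \<Rightarrow> 'a topology \<Rightarrow> ('a \<Rightarrow> complex) topology" where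
  "dual_topology G T = topology (\<lambda>U.
     U \<subseteq> characters G T \<and>
     (\<forall>\<phi>\<in>U. \<exists>K e. compactin T K \<and> e > 0 \<and>
        {\<psi> \<in> characters G T. \<forall>x\<in>K. dist (\<psi> x) (\<phi> x) < e} \<subseteq> U))"

definition evaluation :: "('a, 'm) monoid_scheme \<Rightarrow> 'a topology \<Rightarrow> 'a \<Rightarrow> ('a \<Rightarrow> complex) \<Rightarrow> complex" where
  "evaluation G T x = (\<lambda>\<phi>\<in>characters G T. \<phi> x)"

definition reflexive_group :: "('a, 'm) monoid_scheme \<Rightarrow> 'a topology \<Rightarrow> bool" where
  "reflexive_group G T \<longleftrightarrow>
     evaluation G T \<in> iso G (dual_group (dual_group G T) (dual_topology G T)) \<and>
     homeomorphic_map T (dual_topology (dual_group G T) (dual_topology G T)) (evaluation G T)"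

definition P_modification :: "'a topology \<Rightarrow> 'a topology" where
  "P_modification T = topology (arbitrary union_of gdelta_in T)"

definition supp :: "'i set \<Rightarrow> ('i \<Rightarrow> ('a, 'm) monoid_scheme) \<Rightarrow> ('i \<Rightarrow> 'a) \<Rightarrow> 'i set" where
  "supp I D x = {i \<in> I. x i \<noteq> \<one>\<^bsub>D i\<^esub>}"

definition Sigma_product :: "'i set \<Rightarrow> ('i \<Rightarrow> ('a, 'm) monoid_scheme) \<Rightarrow> ('i \<Rightarrow> 'a) set" where
  "Sigma_product I D = {x \<in> carrier (product_group I D). countable (supp I D x)}"

lemma openin_dual_topology:
  "openin (dual_topology G T) U \<longleftrightarrow>
     U \<subseteq> characters G T \<and>
     (\<forall>\<phi>\<in>U. \<exists>K e. compactin T K \<and> e > 0 \<and>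
        {\<psi> \<in> characters G T. \<forall>x\<in>K. dist (\<psi> x) (\<phi> x) < e} \<subseteq> U)"
proof -
  let ?N = "\<lambda>\<phi> K e. {\<psi> \<in> characters G T. \<forall>x\<in>K. dist (\<psi> x) (\<phi> x) < e}"
  let ?P = "\<lambda>U. U \<subseteq> characters G T \<and>
     (\<forall>\<phi>\<in>U. \<exists>K e. compactin T K \<and> e > 0 \<and> ?N \<phi> K e \<subseteq> U)"
  have "istopology ?P"
    unfolding istopology_def
  proof (intro conjI allI impI)
    fix S S' assume S: "?P S" and S': "?P S'"
    then show "S \<inter> S' \<subseteq> characters G T" by blast
    show "\<forall>\<phi>\<in>S \<inter> S'. \<exists>K e. compactin T K \<and> e > 0 \<and> ?N \<phi> K e \<subseteq> S \<inter> S'"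
    proof
      fix \<phi> assume "\<phi> \<in> S \<inter> S'"
      with S S' obtain K e K' e' where K: "compactin T K" "e > 0" "?N \<phi> K e \<subseteq> S"
        and K': "compactin T K'" "e' > 0" "?N \<phi> K' e' \<subseteq> S'"
        by (meson IntD1 IntD2)
      have "compactin T (K \<union> K')" "min e e' > 0"
        using K K' by (auto intro: compactin_Un)
      moreover have "?N \<phi> (K \<union> K') (min e e') \<subseteq> S \<inter> S'"
      proof -
        have "?N \<phi> (K \<union> K') (min e e') \<subseteq> ?N \<phi> K e \<inter> ?N \<phi> K' e'" by auto
        then show ?thesis using K(3) K'(3) by blast
      qed
      ultimately show "\<exists>K e. compactin T K \<and> e > 0 \<and> ?N \<phi> K e \<subseteq> S \<inter> S'"
        by blast
    qed
  next
    fix \<K> assume A: "\<forall>S\<in>\<K>. ?P S"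
    then show "\<Union>\<K> \<subseteq> characters G T" by blast
    show "\<forall>\<phi>\<in>\<Union>\<K>. \<exists>K e. compactin T K \<and> e > 0 \<and> ?N \<phi> K e \<subseteq> \<Union>\<K>"
    proof
      fix \<phi> assume "\<phi> \<in> \<Union>\<K>"
      then obtain S where S: "S \<in> \<K>" "\<phi> \<in> S" by blast
      with A obtain K e where "compactin T K" "e > 0" "?N \<phi> K e \<subseteq> S" by meson
      with S(1) show "\<exists>K e. compactin T K \<and> e > 0 \<and> ?N \<phi> K e \<subseteq> \<Union>\<K>"
        by (meson Union_upper subset_trans)
    qed
  qed
  then show ?thesis
    by (simp add: dual_topology_def topology_inverse')
qed

lemma topspace_dual_topology: "topspace (dual_topology G T) = characters G T"
proof
  show "topspace (dual_topology G T) \<subseteq> characters G T"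
    using openin_dual_topology openin_topspace by blast
  have "\<exists>K e. compactin T K \<and> e > 0 \<and>
      {\<psi> \<in> characters G T. \<forall>x\<in>K. dist (\<psi> x) (\<phi> x) < e} \<subseteq> characters G T" for \<phi>
    by (rule exI[of _ "{}"], rule exI[of _ 1]) auto
  then have "openin (dual_topology G T) (characters G T)"
    by (simp add: openin_dual_topology)
  then show "characters G T \<subseteq> topspace (dual_topology G T)"
    by (rule openin_subset)
qed

lemma openin_P_modification:
  "openin (P_modification T) = arbitrary union_of gdelta_in T"
  unfolding P_modification_def
  by (intro topology_inverse' istopology_base gdelta_in_Int)

lemma topspace_P_modification: "topspace (P_modification T) = topspace T"
proof
  show "topspace (P_modification T) \<subseteq> topspace T"
    using openin_topspace[of "P_modification T"] gdelta_in_subset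
    by (fastforce simp: openin_P_modification union_of_def)
  show "topspace T \<subseteq> topspace (P_modification T)"
    by (simp add: openin_P_modification openin_subset arbitrary_union_of_inc)
qed

end

theory Submission
  imports Defs "HOL-Library.Countable_Set_Type"
begin

text \<open>Since \<open>G\<close> and its projections \<open>\<pi>\<^sub>J(G)\<close> are Hausdorff P-spaces, their compact subsets are finite and
  their dual groups carry the topology of pointwise convergence. By the Comfort-Ross theorem the
  evaluation map is then always onto the bidual, so reflexivity amounts to two conditions: neighbourhoods
  of the identity are detected by compact sets of characters, and each compact set of characters is
  trivial on a neighbourhood of the identity.

  Neighbourhoods in \<open>G\<close> depend on countably many coordinates, and setting all coordinates outside a
  countable set \<open>C\<close> to the identity is a continuous homomorphism with values in the \<open>\<Sigma>\<close>-product, hence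
  in \<open>G\<close>. This transfers both conditions between \<open>G\<close> and \<open>\<pi>\<^sub>J(G)\<close>, except for the second one from the
  projections to \<open>G\<close>: there one needs a countable \<open>C\<close> such that a given compact set \<open>K\<close> of characters
  of \<open>G\<close> factors through \<open>\<pi>\<^sub>C\<close>. If there is none, an increasing \<open>\<omega>\<^sub>1\<close>-chain of countable sets refuting
  each other has a union \<open>J\<close> of size at most \<open>\<aleph>\<^sub>1\<close>. The members of \<open>K\<close> factoring through \<open>\<pi>\<^sub>J\<close> form a
  compact set, so by reflexivity of \<open>\<pi>\<^sub>J(G)\<close> they factor through a countable subset of \<open>J\<close>, which lies
  below some stage of the chain, a contradiction.\<close>

subsection \<open>Characters determined by finitely many characters\<close>

text \<open>For \<open>z \<noteq> 1\<close> the geometric sums stay below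
  \<open>2 / norm (1 - z)\<close>, so the division by \<open>N\<close> sends them to 0.\<close>

lemma mean_powers_tendsto:
  fixes z :: complex
  assumes "norm z = 1"
  shows "(\<lambda>N. (\<Sum>j<N. z ^ j) / of_nat N) \<longlonglongrightarrow> (if z = 1 then 1 else 0)"
proof (cases "z = 1")
  case True
  have "\<forall>\<^sub>F N in sequentially. (\<Sum>j<N. z ^ j) / of_nat N = 1"
    using eventually_gt_at_top[of 0] by eventually_elim (simp add: True)
  then show ?thesis
    using True by (simp add: tendsto_eventually)
next
  case False
  have "norm ((\<Sum>j<N. z ^ j) / of_nat N) \<le> (2 / norm (1 - z)) * inverse (real N)" for N
  proof -
    have "norm (1 - z ^ N) \<le> 2"
      using norm_triangle_ineq4[of 1 "z ^ N"] assms by (simp add: norm_power)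
    then have "norm (\<Sum>j<N. z ^ j) \<le> 2 / norm (1 - z)"
      using False by (simp add: sum_gp_strict norm_divide divide_right_mono)
    then show ?thesis
      by (simp add: norm_divide divide_inverse norm_mult norm_inverse mult_right_mono)
  qed
  moreover have "(\<lambda>N. (2 / norm (1 - z)) * inverse (real N)) \<longlonglongrightarrow> 0"
    by (rule tendsto_mult_right_zero) (rule lim_inverse_n)
  ultimately have "(\<lambda>N. (\<Sum>j<N. z ^ j) / of_nat N) \<longlonglongrightarrow> 0"
    by (rule Lim_null_comparison[OF always_eventually[OF allI]])
  then show ?thesis using False by simp
qed

text \<open>Averaging over the powers of an element \<open>t\<close> kills every character with \<open>m k t \<noteq> 1\<close>,
  so averaging keeps lower bounds and leaves only the trivial characters.\<close>

lemma trig_polynomial_mean_ge: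
  fixes H :: "('h, 'z) monoid_scheme" and m :: "'k \<Rightarrow> 'h \<Rightarrow> complex" and b :: "'k \<Rightarrow> complex"
  assumes "monoid H" "finite K"
    and norm: "\<And>k h. k \<in> K \<Longrightarrow> h \<in> carrier H \<Longrightarrow> norm (m k h) = 1"
    and mult: "\<And>k g h. k \<in> K \<Longrightarrow> g \<in> carrier H \<Longrightarrow> h \<in> carrier H \<Longrightarrow>
                 m k (g \<otimes>\<^bsub>H\<^esub> h) = m k g * m k h"
    and ge: "\<And>h. h \<in> carrier H \<Longrightarrow> r \<le> Re (\<Sum>k\<in>K. b k * m k h)"
  shows "r \<le> Re (\<Sum>k | k \<in> K \<and> (\<forall>t\<in>carrier H. m k t = 1). b k)"
  using \<open>finite K\<close> norm mult ge
proof (induction K rule: finite_psubset_induct)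
  case (psubset K)
  interpret monoid H by fact
  \<comment> \<open>The extra factor \<open>h\<close> spares a separate computation of
    \<open>m k\<close> at the identity in the base case.\<close>
  have m_pow: "m k (h \<otimes>\<^bsub>H\<^esub> (t [^]\<^bsub>H\<^esub> j)) = m k h * m k t ^ j"
    if "k \<in> K" "h \<in> carrier H" "t \<in> carrier H" for k h t and j :: nat
    using that
  proof (induction j)
    case 0
    then show ?case by simp
  next
    case (Suc j)
    have "h \<otimes>\<^bsub>H\<^esub> (t [^]\<^bsub>H\<^esub> Suc j) = (h \<otimes>\<^bsub>H\<^esub> (t [^]\<^bsub>H\<^esub> j)) \<otimes>\<^bsub>H\<^esub> t"
      using Suc.prems by (simp add: m_assoc)
    moreover have "m k (h \<otimes>\<^bsub>H\<^esub> (t [^]\<^bsub>H\<^esub> j)) = m k h * m k t ^ j"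
      using Suc by simp
    moreover have "m k ((h \<otimes>\<^bsub>H\<^esub> (t [^]\<^bsub>H\<^esub> j)) \<otimes>\<^bsub>H\<^esub> t) = m k (h \<otimes>\<^bsub>H\<^esub> (t [^]\<^bsub>H\<^esub> j)) * m k t"
      using Suc.prems by (intro psubset.prems(2)) auto
    ultimately show ?case by simp
  qed
  show ?case
  proof (cases "\<forall>k\<in>K. \<forall>t\<in>carrier H. m k t = 1")
    case True
    then have "r \<le> Re (\<Sum>k\<in>K. b k)"
      using psubset.prems(3)[OF one_closed] by simp
    moreover have "{k \<in> K. \<forall>t\<in>carrier H. m k t = 1} = K"
      using True by auto
    ultimately show ?thesis by simp
  next
    case False
    then obtain k0 t where k0: "k0 \<in> K" and t: "t \<in> carrier H" "m k0 t \<noteq> 1"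
      by auto
    \<comment> \<open>These are the terms that survive averaging over the powers of
      \<open>t\<close>; \<open>k0\<close> is dropped, so the induction hypothesis applies to the
      averaged sum.\<close>
    define K' where "K' = {k \<in> K. m k t = 1}"
    have "K' \<subset> K"
      using k0 t by (auto simp: K'_def)
    moreover have "r \<le> Re (\<Sum>k\<in>K'. b k * m k h)" if h: "h \<in> carrier H" for h
    proof -
      define F where "F = (\<lambda>N::nat. \<Sum>k\<in>K. b k * m k h * ((\<Sum>j<N. m k t ^ j) / of_nat N))"
      have "F \<longlonglongrightarrow> (\<Sum>k\<in>K. b k * m k h * (if m k t = 1 then 1 else 0))"
        unfolding F_def
        by (intro tendsto_sum tendsto_mult tendsto_const mean_powers_tendsto psubset.prems t)
      also have "(\<Sum>k\<in>K. b k * m k h * (if m k t = 1 then 1 else 0)) = (\<Sum>k\<in>K'. b k * m k h)"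
        unfolding K'_def by (subst sum.inter_filter[OF psubset.hyps(1)]) (rule sum.cong, auto)
      finally have lim: "(\<lambda>N. Re (F N)) \<longlonglongrightarrow> Re (\<Sum>k\<in>K'. b k * m k h)"
        by (rule tendsto_Re)
      \<comment> \<open>For \<open>N \<ge> 1\<close>, \<open>F N\<close> is the mean of the original
        sum over the points \<open>h\<close> times \<open>t\<close> to the power \<open>j\<close>,
        \<open>j < N\<close>, and each of them satisfies the lower bound. At \<open>N = 0\<close>
        division by zero makes \<open>F N\<close> zero, whatever \<open>r\<close> is.\<close>
      have "r \<le> Re (F N)" if "N \<ge> 1" for N
      proof -
        have "F N = (\<Sum>j<N. \<Sum>k\<in>K. b k * m k (h \<otimes>\<^bsub>H\<^esub> (t [^]\<^bsub>H\<^esub> j))) / of_nat N"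
          unfolding F_def
          by (subst sum.swap) (simp add: m_pow h t sum_distrib_left sum_divide_distrib mult.assoc)
        moreover have "real N * r \<le> Re (\<Sum>j<N. \<Sum>k\<in>K. b k * m k (h \<otimes>\<^bsub>H\<^esub> (t [^]\<^bsub>H\<^esub> j)))"
          unfolding Re_sum[of _ "{..<N}"]
          by (rule order_trans[OF _ sum_bounded_below[where K = r]])
            (auto simp del: Re_sum intro!: psubset.prems(3) h t)
        ultimately show ?thesis
          using that by (simp only: Re_divide_of_nat) (simp add: pos_le_divide_eq mult.commute[of r] del: Re_sum)
      qed
      then show ?thesis
        using lim by (intro LIMSEQ_le_const[OF lim]) blast
    qed
    ultimately have "r \<le> Re (\<Sum>k | k \<in> K' \<and> (\<forall>t\<in>carrier H. m k t = 1). b k)"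
      using psubset.prems by (intro psubset.IH) (auto simp: K'_def)
    moreover have "{k \<in> K'. \<forall>t\<in>carrier H. m k t = 1} = {k \<in> K. \<forall>t\<in>carrier H. m k t = 1}"
      using t(1) by (auto simp: K'_def)
    ultimately show ?thesis by simp
  qed
qed

section \<open>The Fejer-type kernel\<close>

text \<open>Exponential decay beats polynomial decay. Later \<open>q ^ M\<close> bounds the kernel
  away from 1, and the right-hand side bounds its constant coefficient from below, with
  \<open>n\<close> the number of characters.\<close>

lemma exists_power_small:
  fixes q :: real
  assumes "0 \<le> q" "q < 1"
  shows "\<exists>M>0. 4 * q ^ M < (1 / (2 * real M)) ^ n"
proof (cases "q = 0")
  case True
  then show ?thesis by (intro exI[of _ 1]) (auto simp: zero_less_power)
next
  case False
  define s where "s = - ln q"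
  have "s > 0" using assms False by (simp add: s_def ln_less_zero)
  have "(\<lambda>M. (s * real M) ^ n / exp (s * real M)) \<longlonglongrightarrow> 0"
    by (rule filterlim_compose[OF tendsto_power_div_exp_0])
      (use \<open>s > 0\<close> in \<open>auto intro!: filterlim_tendsto_pos_mult_at_top[OF tendsto_const] filterlim_real_sequentially\<close>)
  \<comment> \<open>The constant turns \<open>(s * M) ^ n\<close> into
    \<open>4 * (2 * M) ^ n\<close>; since \<open>q ^ M = 1 / exp (s * M)\<close>, a value below 1 is
    exactly the claim.\<close>
  then have "(\<lambda>M. (4 * (2 / s) ^ n) * ((s * real M) ^ n / exp (s * real M))) \<longlonglongrightarrow> 0"
    by (rule tendsto_mult_right_zero)
  then have "\<forall>\<^sub>F M in sequentially. (4 * (2 / s) ^ n) * ((s * real M) ^ n / exp (s * real M)) < 1"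
    by (rule order_tendstoD) simp
  then have "\<forall>\<^sub>F M in sequentially. M > 0 \<and> (4 * (2 / s) ^ n) * ((s * real M) ^ n / exp (s * real M)) < 1"
    using eventually_gt_at_top[of 0] by eventually_elim simp
  then obtain M :: nat where M: "M > 0"
      "(4 * (2 / s) ^ n) * ((s * real M) ^ n / exp (s * real M)) < 1"
    by (auto dest: eventually_happens)
  have "q ^ M = 1 / exp (s * real M)"
    using assms False by (simp add: s_def exp_minus flip: ln_realpow powr_realpow)
      (simp add: powr_def exp_minus mult.commute divide_inverse)
  moreover have "(2 / s) ^ n * (s * real M) ^ n = (2 * real M) ^ n"
    using \<open>s > 0\<close> unfolding power_mult_distrib[symmetric] by simp
  ultimately have "4 * q ^ M * (2 * real M) ^ n < 1"
    using M(2) by (simp add: mult.assoc mult.commute mult.left_commute)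
  then show ?thesis
    using M(1) by (intro exI[of _ M]) (simp add: power_divide power_one_over field_simps)
qed

text \<open>On the unit circle \<open>cnj z = inverse z\<close>, so the square of
  \<open>norm (1 + z)\<close> is \<open>(z + 1)\<close> squared over \<open>z\<close>, and the
  binomial theorem expands its powers. The term \<open>j = M\<close> is the constant one.\<close>

lemma fejer_factor:
  fixes z :: complex
  assumes "norm z = 1"
  shows "of_real ((norm (1 + z) / 2) ^ (2 * M)) =
    (\<Sum>j\<le>2 * M. of_real (real ((2 * M) choose j) / 4 ^ M) * z powi (int j - int M))"
proof -
  have z: "z \<noteq> 0" using assms by auto
  have "cnj z = inverse z"
    using complex_norm_square[of z] assms by (simp add: inverse_unique)
  then have "of_real ((norm (1 + z))\<^sup>2) = (1 + z) * (1 + inverse z)"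
    by (simp only: complex_norm_square complex_cnj_add complex_cnj_one)
  also have "\<dots> = (z + 1)\<^sup>2 / z"
    using z by (simp add: field_simps power2_eq_square)
  finally have "of_real ((norm (1 + z) / 2)\<^sup>2) = (z + 1)\<^sup>2 / (4 * z)"
    by (simp add: power_divide)
  then have "of_real ((norm (1 + z) / 2) ^ (2 * M)) = (z + 1) ^ (2 * M) / (4 ^ M * z ^ M)"
    unfolding power_mult of_real_power[of _ M] by (simp only: power_divide[of _ _ M] power_mult_distrib[of _ _ M])
  also have "\<dots> = (\<Sum>j\<le>2 * M. of_nat ((2 * M) choose j) * z ^ j / (4 ^ M * z ^ M))"
    by (simp add: binomial_ring sum_divide_distrib)
  also have "\<dots> = (\<Sum>j\<le>2 * M. of_real (real ((2 * M) choose j) / 4 ^ M) * z powi (int j - int M))"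
    using z by (intro sum.cong refl) (simp add: power_int_diff)
  finally show ?thesis .
qed

text \<open>This is the theorem of Comfort and Ross on the characters of a precompact group. If \<open>f\<close> is
  none of the products, testing \<open>p (cnj f - 1/2)\<close>, with \<open>p\<close> a high power of the Fejer-type kernel
  \<open>\<Prod>k. (norm (1 + x k) / 2)\<^sup>2\<close>, against the mean contradicts the polynomial lower bound for the
  constant coefficient of \<open>p\<close>.\<close>

lemma character_eq_prod_powi:
  fixes H :: "('h, 'z) monoid_scheme" and x :: "'k \<Rightarrow> 'h \<Rightarrow> complex" and f :: "'h \<Rightarrow> complex"
  assumes "monoid H" "finite K" "e > 0"
    and x_norm: "\<And>k h. k \<in> K \<Longrightarrow> h \<in> carrier H \<Longrightarrow> norm (x k h) = 1"
    and x_mult: "\<And>k g h. k \<in> K \<Longrightarrow> g \<in> carrier H \<Longrightarrow> h \<in> carrier H \<Longrightarrow>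
                   x k (g \<otimes>\<^bsub>H\<^esub> h) = x k g * x k h"
    and f_norm: "\<And>h. h \<in> carrier H \<Longrightarrow> norm (f h) = 1"
    and f_mult: "\<And>g h. g \<in> carrier H \<Longrightarrow> h \<in> carrier H \<Longrightarrow> f (g \<otimes>\<^bsub>H\<^esub> h) = f g * f h"
    and close: "\<And>h. h \<in> carrier H \<Longrightarrow> (\<And>k. k \<in> K \<Longrightarrow> norm (x k h - 1) < e) \<Longrightarrow> norm (f h - 1) \<le> 1/2"
  shows "\<exists>n :: 'k \<Rightarrow> int. \<forall>h\<in>carrier H. f h = (\<Prod>k\<in>K. x k h powi n k)"
proof (rule ccontr)
  assume contr: "\<not> ?thesis"
  define d where "d = min e 1"
  have d: "0 < d" "d \<le> e" "d \<le> 1" using \<open>e > 0\<close> by (auto simp: d_def)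
  \<comment> \<open>For \<open>norm z = 1\<close> the squares of \<open>norm (1 + z)\<close> and
    \<open>norm (z - 1)\<close> add up to 4, so \<open>q\<close> bounds the square of
    \<open>norm (1 + z) / 2\<close> when \<open>z\<close> is at distance at least \<open>d\<close>
    from 1. Capping \<open>d\<close> at 1 keeps \<open>q\<close> nonnegative.\<close>
  define q where "q = 1 - d\<^sup>2 / 4"
  have "d\<^sup>2 \<le> 1" using d by (simp add: power_le_one)
  then have q: "0 \<le> q" "q < 1" using d by (auto simp: q_def)
  then obtain M where M: "M > 0" "4 * q ^ M < (1 / (2 * real M)) ^ card K"
    using exists_power_small by blast
  define \<Phi> where "\<Phi> = (\<Pi>\<^sub>E k\<in>K. {..2 * M})"
  define a where "a = (\<lambda>\<phi>. \<Prod>k\<in>K. real ((2 * M) choose \<phi> k) / 4 ^ M)"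
  define mm where "mm = (\<lambda>\<phi> h. \<Prod>k\<in>K. x k h powi (int (\<phi> k) - int M))"
  define p where "p = (\<lambda>h. \<Prod>k\<in>K. (norm (1 + x k h) / 2) ^ (2 * M))"
  have "finite \<Phi>" using \<open>finite K\<close> by (simp add: \<Phi>_def finite_PiE)
  have p_sum: "of_real (p h) = (\<Sum>\<phi>\<in>\<Phi>. of_real (a \<phi>) * mm \<phi> h)" if "h \<in> carrier H" for h
  proof -
    have "of_real (p h) = (\<Prod>k\<in>K. \<Sum>j\<le>2 * M. of_real (real ((2 * M) choose j) / 4 ^ M) * x k h powi (int j - int M))"
      unfolding p_def of_real_prod using that by (intro prod.cong refl fejer_factor x_norm)
    also have "\<dots> = (\<Sum>\<phi>\<in>\<Phi>. of_real (a \<phi>) * mm \<phi> h)"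
      unfolding \<Phi>_def a_def mm_def of_real_prod prod.distrib[symmetric]
      by (rule prod_sum_PiE) (use \<open>finite K\<close> in auto)
    finally show ?thesis .
  qed
  have x_nz: "x k h \<noteq> 0" if "k \<in> K" "h \<in> carrier H" for k h
    using x_norm[OF that] by auto
  have mm_norm: "norm (mm \<phi> h) = 1" if "h \<in> carrier H" for \<phi> h
    using that by (simp add: mm_def x_norm norm_power_int flip: prod_norm)
  have mm_mult: "mm \<phi> (g \<otimes>\<^bsub>H\<^esub> h) = mm \<phi> g * mm \<phi> h" if "g \<in> carrier H" "h \<in> carrier H" for \<phi> g h
    using that by (simp add: mm_def x_mult power_int_mult_distrib flip: prod.distrib)
  \<comment> \<open>With \<open>b\<close> this writes \<open>p * (cnj f - 1/2)\<close> as a sum of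
    multiplicative terms: the flag \<open>s\<close> separates the monomials of
    \<open>p * cnj f\<close> from those of \<open>- p / 2\<close>.\<close>
  define m where "m = (\<lambda>(\<phi>, s) h. mm \<phi> h * (if s then cnj (f h) else 1))"
  define b where "b = (\<lambda>(\<phi>, s). complex_of_real (a \<phi>) * (if s then 1 else - 1 / 2))"
  have p_nonneg: "0 \<le> p h" for h
    by (auto simp: p_def intro: prod_nonneg)
  have Re_f: "- 1 \<le> Re (f h)" if "h \<in> carrier H" for h
    using abs_Re_le_cmod[of "f h"] f_norm[OF that] by linarith
  \<comment> \<open>If all \<open>x k h\<close> are near 1, then \<open>Re (f h) \<ge> 1/2\<close>
    and the product is nonnegative. Otherwise one factor of \<open>p h\<close> is at most
    \<open>q ^ M\<close>, the others are at most 1, and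
    \<open>Re (f h) - 1/2 \<ge> - 3/2\<close>.\<close>
  have bound: "- 2 * q ^ M \<le> p h * (Re (f h) - 1 / 2)" if h: "h \<in> carrier H" for h
  proof (cases "\<forall>k\<in>K. norm (x k h - 1) < e")
    case True
    then have "norm (f h - 1) \<le> 1 / 2" using close h by blast
    then have "Re (f h) \<ge> 1 / 2"
      using abs_Re_le_cmod[of "f h - 1"] by simp
    then have "0 \<le> p h * (Re (f h) - 1 / 2)" using p_nonneg by simp
    moreover have "0 \<le> q ^ M" using q by simp
    ultimately show ?thesis by linarith
  next
    case False
    then obtain k where k: "k \<in> K" "norm (x k h - 1) \<ge> d" using d by force
    have factor: "(norm (1 + x l h) / 2) ^ (2 * M) \<le> 1" if "l \<in> K" for l
      using norm_triangle_ineq[of 1 "x l h"] x_norm[OF that h] by (intro power_le_one) auto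
    have "(norm (1 + x k h))\<^sup>2 + (norm (x k h - 1))\<^sup>2 = 4"
    proof -
      have "(Re (x k h))\<^sup>2 + (Im (x k h))\<^sup>2 = 1"
        using x_norm[OF k(1) h] by (simp add: cmod_def)
      then show ?thesis
        unfolding cmod_power2 by (simp add: power2_eq_square algebra_simps)
    qed
    moreover have "d\<^sup>2 \<le> (norm (x k h - 1))\<^sup>2" using k d by (intro power_mono) auto
    ultimately have "(norm (1 + x k h) / 2)\<^sup>2 \<le> q" by (simp add: q_def power_divide)
    then have "(norm (1 + x k h) / 2) ^ (2 * M) \<le> q ^ M"
      unfolding power_mult by (rule power_mono) simp
    moreover have "p h = (norm (1 + x k h) / 2) ^ (2 * M) * (\<Prod>l\<in>K - {k}. (norm (1 + x l h) / 2) ^ (2 * M))"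
      unfolding p_def using k \<open>finite K\<close> by (simp add: prod.remove)
    moreover have "(\<Prod>l\<in>K - {k}. (norm (1 + x l h) / 2) ^ (2 * M)) \<le> 1"
      using factor by (intro prod_le_1) auto
    moreover have "0 \<le> (\<Prod>l\<in>K - {k}. (norm (1 + x l h) / 2) ^ (2 * M))"
      by (intro prod_nonneg) auto
    ultimately have "p h \<le> q ^ M * 1"
      using zero_le_power[OF q(1), of M] by (simp only: mult_mono)
    then have "p h * (3 / 2) \<le> 2 * q ^ M" using p_nonneg[of h] by linarith
    moreover have "p h * (- 3 / 2) \<le> p h * (Re (f h) - 1 / 2)"
      using Re_f[OF h] p_nonneg by (intro mult_left_mono) auto
    ultimately show ?thesis by linarith
  qed
  have "- 2 * q ^ M \<le> Re (\<Sum>k\<in>\<Phi> \<times> UNIV. b k * m k h)" if h: "h \<in> carrier H" for h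
  proof -
    have "(\<Sum>k\<in>\<Phi> \<times> (UNIV :: bool set). b k * m k h) =
        (\<Sum>\<phi>\<in>\<Phi>. \<Sum>s\<in>UNIV. b (\<phi>, s) * m (\<phi>, s) h)"
      by (simp add: sum.cartesian_product)
    also have "\<dots> = (\<Sum>\<phi>\<in>\<Phi>. of_real (a \<phi>) * mm \<phi> h) * (cnj (f h) - 1 / 2)"
      unfolding sum_distrib_right
      by (intro sum.cong refl) (simp add: UNIV_bool b_def m_def algebra_simps)
    also have "\<dots> = of_real (p h) * (cnj (f h) - 1 / 2)"
      using p_sum[OF h] by simp
    finally show ?thesis using bound[OF h] by simp
  qed
  then have le: "- 2 * q ^ M \<le> Re (\<Sum>k | k \<in> \<Phi> \<times> UNIV \<and> (\<forall>t\<in>carrier H. m k t = 1). b k)"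
  proof (intro trig_polynomial_mean_ge[where m = m])
    fix k h assume "k \<in> \<Phi> \<times> (UNIV :: bool set)" "h \<in> carrier H"
    then show "norm (m k h) = 1"
      by (cases k) (simp add: m_def norm_mult mm_norm f_norm)
  next
    fix k g h assume "k \<in> \<Phi> \<times> (UNIV :: bool set)" "g \<in> carrier H" "h \<in> carrier H"
    then show "m k (g \<otimes>\<^bsub>H\<^esub> h) = m k g * m k h"
      by (cases k) (simp add: m_def mm_mult f_mult)
  qed (use \<open>monoid H\<close> \<open>finite \<Phi>\<close> in auto)
  \<comment> \<open>A trivial term with flag \<open>True\<close> would make \<open>f\<close> equal
    to a monomial, which is excluded; hence only terms of \<open>- p / 2\<close> contribute to the
    mean.\<close>
  have no_f: "\<not> (\<forall>t\<in>carrier H. m (\<phi>, True) t = 1)" for \<phi>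
  proof
    assume triv: "\<forall>t\<in>carrier H. m (\<phi>, True) t = 1"
    have "f h = mm \<phi> h" if h: "h \<in> carrier H" for h
    proof -
      have "mm \<phi> h * cnj (f h) * f h = f h" using triv h by (simp add: m_def)
      moreover have "cnj (f h) * f h = 1"
        using complex_norm_square[of "f h"] f_norm[OF h] by (simp add: mult.commute)
      ultimately show ?thesis by (simp add: mult.assoc)
    qed
    then have "\<forall>h\<in>carrier H. f h = (\<Prod>k\<in>K. x k h powi (\<lambda>k. int (\<phi> k) - int M) k)"
      by (simp add: mm_def)
    then show False by (rule notE[OF contr exI])
  qed
  define \<Psi> where "\<Psi> = {\<phi> \<in> \<Phi>. \<forall>t\<in>carrier H. mm \<phi> t = 1}"
  have "{k. k \<in> \<Phi> \<times> UNIV \<and> (\<forall>t\<in>carrier H. m k t = 1)} = (\<lambda>\<phi>. (\<phi>, False)) ` \<Psi>"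
  proof (intro equalityI subsetI)
    fix k assume k: "k \<in> {k. k \<in> \<Phi> \<times> UNIV \<and> (\<forall>t\<in>carrier H. m k t = 1)}"
    then have "\<not> snd k" using no_f[of "fst k"] by (cases k) auto
    with k show "k \<in> (\<lambda>\<phi>. (\<phi>, False)) ` \<Psi>" by (cases k) (auto simp: \<Psi>_def m_def)
  qed (auto simp: \<Psi>_def m_def)
  then have "Re (\<Sum>k | k \<in> \<Phi> \<times> UNIV \<and> (\<forall>t\<in>carrier H. m k t = 1). b k) = - (\<Sum>\<phi>\<in>\<Psi>. a \<phi>) / 2"
    by (simp add: sum.reindex inj_on_def b_def sum_negf sum_divide_distrib)
  moreover have "(1 / (2 * real M)) ^ card K \<le> (\<Sum>\<phi>\<in>\<Psi>. a \<phi>)"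
  proof -
    \<comment> \<open>After the shift by \<open>M\<close> this is the zero exponent, so its monomial
      is constant; its coefficient comes from central binomial coefficients, each at least
      \<open>4 ^ M / (2 * M)\<close>.\<close>
    define \<phi>0 where "\<phi>0 = (\<lambda>k\<in>K. M)"
    have "\<phi>0 \<in> \<Psi>" by (auto simp: \<phi>0_def \<Psi>_def \<Phi>_def mm_def)
    have "1 / (2 * real M) \<le> real ((2 * M) choose M) / 4 ^ M"
      using central_binomial_lower_bound[OF M(1)] M(1) by (simp add: field_simps)
    then have "(1 / (2 * real M)) ^ card K \<le> a \<phi>0"
      by (simp add: a_def \<phi>0_def power_mono)
    also have "\<dots> \<le> (\<Sum>\<phi>\<in>\<Psi>. a \<phi>)"
      using \<open>\<phi>0 \<in> \<Psi>\<close> \<open>finite \<Phi>\<close> by (intro member_le_sum) (auto simp: \<Psi>_def a_def intro!: prod_nonneg)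
    finally show ?thesis .
  qed
  \<comment> \<open>The mean is at least \<open>- 2 * q ^ M\<close>, yet it equals minus half a sum
    that is at least \<open>(1 / (2 * M)) ^ card K > 4 * q ^ M\<close>.\<close>
  ultimately show False using le M(2) by linarith
qed

subsection \<open>Reflexivity of P-groups\<close>

lemma continuous_map_complex_mult:
  fixes f g :: "'a \<Rightarrow> complex"
  assumes "continuous_map X euclidean f" "continuous_map X euclidean g"
  shows "continuous_map X euclidean (\<lambda>x. f x * g x)"
  using assms by (simp add: continuous_map_atin tendsto_mult)

lemma hom_circle_group_iff:
  "\<phi> \<in> hom G circle_group \<longleftrightarrow>
     (\<forall>x\<in>carrier G. norm (\<phi> x) = 1) \<and>
     (\<forall>x\<in>carrier G. \<forall>y\<in>carrier G. \<phi> (x \<otimes>\<^bsub>G\<^esub> y) = \<phi> x * \<phi> y)"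
  by (auto simp: hom_def circle_group_def)

text \<open>The uniform bound \<open>d < e\<close> leaves the gap \<open>e - d\<close>, and half of
  it is a radius that stays inside the set.\<close>

lemma openin_dual_nbhd:
  assumes "compactin T K"
  shows "openin (dual_topology G T)
     {\<psi> \<in> characters G T. \<exists>d<e. \<forall>x\<in>K. dist (\<psi> x) (\<phi> x) \<le> d}" (is "openin _ ?U")
  unfolding openin_dual_topology
proof (intro conjI ballI)
  fix \<psi> assume "\<psi> \<in> ?U"
  then obtain d where d: "d < e" "\<forall>x\<in>K. dist (\<psi> x) (\<phi> x) \<le> d" by auto
  have "{\<psi>' \<in> characters G T. \<forall>x\<in>K. dist (\<psi>' x) (\<psi> x) < (e - d) / 2} \<subseteq> ?U"
  proof
    fix \<psi>' assume "\<psi>' \<in> {\<psi>' \<in> characters G T. \<forall>x\<in>K. dist (\<psi>' x) (\<psi> x) < (e - d) / 2}"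
    then have \<psi>': "\<psi>' \<in> characters G T" "\<forall>x\<in>K. dist (\<psi>' x) (\<psi> x) < (e - d) / 2" by auto
    have "dist (\<psi>' x) (\<phi> x) \<le> (e + d) / 2" if "x \<in> K" for x
    proof -
      have "dist (\<psi>' x) (\<psi> x) + dist (\<psi> x) (\<phi> x) \<le> (e - d) / 2 + d"
        using \<psi>'(2) d(2) that by (intro add_mono) (auto simp: less_imp_le)
      then show ?thesis
        using dist_triangle[of "\<psi>' x" "\<phi> x" "\<psi> x"] by (simp add: field_simps)
    qed
    moreover have "(e + d) / 2 < e" using d(1) by simp
    ultimately show "\<psi>' \<in> ?U"
      using \<psi>'(1) by blast
  qed
  then show "\<exists>K e. compactin T K \<and> e > 0 \<and> {\<psi>' \<in> characters G T. \<forall>x\<in>K. dist (\<psi>' x) (\<psi> x) < e} \<subseteq> ?U"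
    using assms d(1) by (intro exI[of _ K] exI[of _ "(e - d) / 2"]) auto
qed auto

lemma continuous_map_dual_eval:
  assumes "x \<in> topspace T"
  shows "continuous_map (dual_topology G T) euclidean (\<lambda>\<xi>. \<xi> x)"
  unfolding continuous_map_def
proof (intro conjI allI impI)
  fix U :: "complex set" assume "openin euclidean U"
  then have U: "open U" by simp
  show "openin (dual_topology G T) {\<xi> \<in> topspace (dual_topology G T). \<xi> x \<in> U}"
    unfolding openin_dual_topology topspace_dual_topology
  proof (intro conjI ballI)
    fix \<phi> assume "\<phi> \<in> {\<xi> \<in> characters G T. \<xi> x \<in> U}"
    then obtain e where e: "e > 0" "ball (\<phi> x) e \<subseteq> U"
      using U open_contains_ball by blast
    have "compactin T {x}" using assms by (simp add: finite_imp_compactin)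
    moreover have "{\<psi> \<in> characters G T. \<forall>y\<in>{x}. dist (\<psi> y) (\<phi> y) < e} \<subseteq> {\<xi> \<in> characters G T. \<xi> x \<in> U}"
      using e(2) by (auto simp: subset_iff dist_commute)
    ultimately show "\<exists>K e. compactin T K \<and> e > 0 \<and>
        {\<psi> \<in> characters G T. \<forall>x\<in>K. dist (\<psi> x) (\<phi> x) < e} \<subseteq> {\<xi> \<in> characters G T. \<xi> x \<in> U}"
      using e(1) by blast
  qed auto
qed auto

lemma hom_circle_group_int_pow:
  assumes "group G" "\<phi> \<in> hom G circle_group" "x \<in> carrier G"
  shows "\<phi> (x [^]\<^bsub>G\<^esub> (n :: int)) = \<phi> x powi n"
proof -
  interpret group G by fact
  have norm: "norm (\<phi> y) = 1" if "y \<in> carrier G" for y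
    using assms(2) that by (simp add: hom_circle_group_iff)
  have mult: "\<phi> (y \<otimes>\<^bsub>G\<^esub> z) = \<phi> y * \<phi> z" if "y \<in> carrier G" "z \<in> carrier G" for y z
    using assms(2) that by (simp add: hom_circle_group_iff)
  have nz: "\<phi> y \<noteq> 0" if "y \<in> carrier G" for y
    using norm[OF that] by auto
  have one: "\<phi> \<one>\<^bsub>G\<^esub> = 1"
    using mult[of "\<one>\<^bsub>G\<^esub>" "\<one>\<^bsub>G\<^esub>"] nz[of "\<one>\<^bsub>G\<^esub>"] by simp
  have pow: "\<phi> (x [^]\<^bsub>G\<^esub> (k :: nat)) = \<phi> x ^ k" for k
    using assms(3) by (induction k) (simp_all add: one mult)
  have "\<phi> (x [^]\<^bsub>G\<^esub> k) * \<phi> (inv\<^bsub>G\<^esub> (x [^]\<^bsub>G\<^esub> k)) = 1" for k :: nat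
    using assms(3) by (simp add: one flip: mult)
  then have pow_inv: "\<phi> (inv\<^bsub>G\<^esub> (x [^]\<^bsub>G\<^esub> k)) = inverse (\<phi> x ^ k)" for k :: nat
    by (metis inverse_unique pow)
  show ?thesis
  proof (cases n rule: int_cases2)
    case (nonneg k)
    then show ?thesis using pow[of k] assms(3) by (simp add: int_pow_int)
  next
    case (nonpos k)
    then show ?thesis using pow_inv[of k] assms(3) by (simp add: int_pow_neg_int power_int_minus)
  qed
qed

section \<open>P-groups: finite compact sets, open kernels, pointwise convergence\<close>

text \<open>The topology enters through translations, which carry conditions at the identity to
  every point, and through the openness of countable intersections of open sets.\<close>

locale P_group = comm_group G for G (structure) +
  fixes T :: "'a topology"
  assumes topspace_T: "topspace T = carrier G"
    and Hausdorff_T: "Hausdorff_space T"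
    and continuous_translation: "a \<in> carrier G \<Longrightarrow> continuous_map T T (\<lambda>x. a \<otimes> x)"
    and openin_countable_Inter:
      "countable \<U> \<Longrightarrow> \<U> \<noteq> {} \<Longrightarrow> (\<And>U. U \<in> \<U> \<Longrightarrow> openin T U) \<Longrightarrow> openin T (\<Inter>\<U>)"
begin

abbreviation "X \<equiv> characters G T"
abbreviation "dual \<equiv> dual_topology G T"

text \<open>The complement is a countable intersection of complements of points.\<close>

lemma closedin_countable:
  assumes "countable A" "A \<subseteq> topspace T"
  shows "closedin T A"
proof (cases "A = {}")
  case False
  have "openin T (\<Inter>a\<in>A. topspace T - {a})"
    using assms False Hausdorff_T
    by (intro openin_countable_Inter) (auto intro!: closedin_Hausdorff_singleton)
  moreover have "(\<Inter>a\<in>A. topspace T - {a}) = topspace T - A"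
    using False by auto
  ultimately show ?thesis using assms(2) by (simp add: closedin_def)
qed auto

text \<open>Every countable set is closed and discrete, so a countably infinite subset would give an
  open cover without finite subcover. Uniform convergence on compact sets thus becomes pointwise
  convergence.\<close>

lemma compactin_finite:
  assumes "compactin T K"
  shows "finite K"
proof (rule ccontr)
  assume "infinite K"
  then obtain A where A: "A \<subseteq> K" "countable A" "infinite A"
    using infinite_countable_subset' by metis
  have KT: "K \<subseteq> topspace T" using assms by (rule compactin_subset_topspace)
  define U where "U = (\<lambda>a. topspace T - (A - {a}))"
  have "openin T (U a)" for a
    unfolding U_def using A KT by (intro openin_diff closedin_countable openin_topspace) auto
  moreover have "K \<subseteq> \<Union> (U ` A)"
    using KT A(3) by (fastforce simp: U_def dest: infinite_imp_nonempty)
  ultimately obtain \<F> where "finite \<F>" "\<F> \<subseteq> U ` A" "K \<subseteq> \<Union>\<F>"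
    using assms unfolding compactin_def by (metis imageE)
  then obtain B where B: "finite B" "B \<subseteq> A" "K \<subseteq> \<Union> (U ` B)"
    by (metis finite_subset_image)
  have "A \<subseteq> B"
  proof
    fix a assume a: "a \<in> A"
    then obtain b where "b \<in> B" "a \<in> U b" using A(1) B(3) by blast
    then show "a \<in> B" using a by (auto simp: U_def)
  qed
  then show False using A(3) B(1) finite_subset by blast
qed

lemma char_norm: "\<xi> \<in> X \<Longrightarrow> x \<in> carrier G \<Longrightarrow> norm (\<xi> x) = 1"
  by (simp add: characters_def hom_circle_group_iff)

lemma char_mult: "\<xi> \<in> X \<Longrightarrow> x \<in> carrier G \<Longrightarrow> y \<in> carrier G \<Longrightarrow> \<xi> (x \<otimes> y) = \<xi> x * \<xi> y"
  by (simp add: characters_def hom_circle_group_iff)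

lemma char_nonzero: "\<xi> \<in> X \<Longrightarrow> x \<in> carrier G \<Longrightarrow> \<xi> x \<noteq> 0"
  using char_norm by fastforce

lemma char_one: "\<xi> \<in> X \<Longrightarrow> \<xi> \<one> = 1"
  using char_mult[of \<xi> \<one> \<one>] char_nonzero[of \<xi> \<one>] by simp

lemma char_inv: "\<xi> \<in> X \<Longrightarrow> x \<in> carrier G \<Longrightarrow> \<xi> (inv x) = inverse (\<xi> x)"
  using char_mult[of \<xi> x "inv x"] by (simp add: char_one inverse_unique)

lemma char_continuous: "\<xi> \<in> X \<Longrightarrow> continuous_map T euclidean \<xi>"
  by (simp add: characters_def continuous_map_in_subtopology)

lemma charI:
  assumes "\<xi> \<in> extensional (carrier G)" "continuous_map T euclidean \<xi>"
    and "\<And>x. x \<in> carrier G \<Longrightarrow> norm (\<xi> x) = 1"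
    and "\<And>x y. x \<in> carrier G \<Longrightarrow> y \<in> carrier G \<Longrightarrow> \<xi> (x \<otimes> y) = \<xi> x * \<xi> y"
  shows "\<xi> \<in> X"
  using assms by (auto simp: characters_def hom_circle_group_iff continuous_map_in_subtopology topspace_T)

text \<open>The kernel is the intersection of the preimages of countably many balls around
  1.\<close>

lemma openin_kernel:
  assumes "\<xi> \<in> X"
  shows "openin T {x \<in> carrier G. \<xi> x = 1}"
proof -
  define U where "U = (\<lambda>n. {x \<in> topspace T. \<xi> x \<in> ball 1 (inverse (real (Suc n)))})"
  have "openin T (\<Inter> (range U))"
    using openin_continuous_map_preimage[OF char_continuous[OF assms]] unfolding U_def
    by (intro openin_countable_Inter) (auto simp del: mem_ball)
  moreover have "\<Inter> (range U) = {x \<in> carrier G. \<xi> x = 1}"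
  proof (intro equalityI subsetI)
    fix x assume x: "x \<in> \<Inter> (range U)"
    then have "dist 1 (\<xi> x) < inverse (real (Suc n))" for n by (auto simp: U_def)
    then have "dist 1 (\<xi> x) \<le> 0"
      by (metis reals_Archimedean not_le less_asym)
    with x show "x \<in> {x \<in> carrier G. \<xi> x = 1}" by (auto simp: U_def topspace_T)
  qed (auto simp: U_def topspace_T)
  ultimately show ?thesis by simp
qed

text \<open>A neighbourhood in the dual constrains values on a compact, hence finite, set only, so
  continuity can be tested one point \<open>x\<close> at a time.\<close>

lemma continuous_map_into_dual:
  assumes "g \<in> topspace Y \<rightarrow> X"
    and "\<And>x. x \<in> carrier G \<Longrightarrow> continuous_map Y euclidean (\<lambda>a. g a x)"
  shows "continuous_map Y dual g"
  unfolding continuous_map_def topspace_dual_topology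
proof (intro conjI allI impI)
  fix U assume U: "openin dual U"
  show "openin Y {a \<in> topspace Y. g a \<in> U}"
  proof (subst openin_subopen, clarify)
    fix a assume a: "a \<in> topspace Y" "g a \<in> U"
    then obtain K e where K: "compactin T K" "e > 0"
        "{\<psi> \<in> X. \<forall>x\<in>K. dist (\<psi> x) (g a x) < e} \<subseteq> U"
      using U unfolding openin_dual_topology by blast
    have "finite K" using K(1) by (rule compactin_finite)
    have "K \<subseteq> carrier G" using compactin_subset_topspace[OF K(1)] topspace_T by simp
    \<comment> \<open>The factor \<open>topspace Y\<close> covers empty \<open>K\<close>, where the
      intersection alone would be the whole type.\<close>
    define W where "W = topspace Y \<inter> (\<Inter>x\<in>K. {b \<in> topspace Y. g b x \<in> ball (g a x) e})"
    have "openin Y W"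
    proof (cases "K = {}")
      case False
      have "openin Y (\<Inter>x\<in>K. {b \<in> topspace Y. g b x \<in> ball (g a x) e})"
        using openin_continuous_map_preimage[OF assms(2)] \<open>K \<subseteq> carrier G\<close> \<open>finite K\<close> False
        by (intro openin_INT2) (auto simp del: mem_ball)
      then show ?thesis unfolding W_def by (intro openin_Int) auto
    qed (simp add: W_def)
    moreover have "a \<in> W" using a K(2) by (auto simp: W_def)
    moreover have "W \<subseteq> {a \<in> topspace Y. g a \<in> U}"
    proof
      fix b assume b: "b \<in> W"
      then have "g b \<in> {\<psi> \<in> X. \<forall>x\<in>K. dist (\<psi> x) (g a x) < e}"
        using assms(1) by (auto simp: W_def dist_commute)
      then show "b \<in> {a \<in> topspace Y. g a \<in> U}" using K(3) b by (auto simp: W_def)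
    qed
    ultimately show "\<exists>W. openin Y W \<and> a \<in> W \<and> W \<subseteq> {a \<in> topspace Y. g a \<in> U}" by blast
  qed
qed (use assms in auto)

section \<open>The bidual and a criterion for reflexivity\<close>

text \<open>This makes the dual an admissible \<open>H\<close> in
  \<open>character_eq_prod_powi\<close>.\<close>

lemma monoid_dual_group: "monoid (dual_group G T)"
proof (rule monoidI)
  fix \<phi> \<psi> assume "\<phi> \<in> carrier (dual_group G T)" "\<psi> \<in> carrier (dual_group G T)"
  then have \<phi>\<psi>: "\<phi> \<in> X" "\<psi> \<in> X" by (auto simp: dual_group_def)
  have "continuous_map T euclidean (\<lambda>x. \<phi> x * \<psi> x)"
    using \<phi>\<psi> by (intro continuous_map_complex_mult char_continuous)
  then have "continuous_map T euclidean (\<lambda>x\<in>carrier G. \<phi> x * \<psi> x)"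
    by (rule continuous_map_eq) (simp add: topspace_T)
  then have "(\<lambda>x\<in>carrier G. \<phi> x * \<psi> x) \<in> X"
    using \<phi>\<psi> by (intro charI) (auto simp: norm_mult char_norm char_mult)
  then show "\<phi> \<otimes>\<^bsub>dual_group G T\<^esub> \<psi> \<in> carrier (dual_group G T)"
    by (simp add: dual_group_def)
next
  have "continuous_map T euclidean (\<lambda>x\<in>carrier G. 1 :: complex)"
    by (rule continuous_map_eq[of _ _ "\<lambda>_. 1"]) (auto simp: topspace_T)
  then have "(\<lambda>x\<in>carrier G. 1) \<in> X"
    by (intro charI) auto
  then show "\<one>\<^bsub>dual_group G T\<^esub> \<in> carrier (dual_group G T)" by (simp add: dual_group_def)
next
  fix \<phi> assume "\<phi> \<in> carrier (dual_group G T)"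
  then have "\<phi> x = undefined" if "x \<notin> carrier G" for x
    using that by (auto simp: dual_group_def characters_def extensional_def)
  then show "\<one>\<^bsub>dual_group G T\<^esub> \<otimes>\<^bsub>dual_group G T\<^esub> \<phi> = \<phi>" "\<phi> \<otimes>\<^bsub>dual_group G T\<^esub> \<one>\<^bsub>dual_group G T\<^esub> = \<phi>"
    by (auto simp: dual_group_def restrict_def fun_eq_iff)
qed (auto simp: dual_group_def fun_eq_iff)

text \<open>The witness is the product of the powers \<open>k [^] n k\<close>, one point for all
  characters at once; it turns a product of evaluations into a single evaluation.\<close>

lemma prod_powi_chars:
  assumes "finite K" "K \<subseteq> carrier G"
  shows "\<exists>y\<in>carrier G. \<forall>\<xi>\<in>X. \<xi> y = (\<Prod>k\<in>K. \<xi> k powi n k)"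
  using assms
proof (induction K rule: finite_induct)
  case empty
  then show ?case by (auto intro!: bexI[of _ \<one>] char_one)
next
  case (insert k K)
  then obtain y where y: "y \<in> carrier G" "\<forall>\<xi>\<in>X. \<xi> y = (\<Prod>k\<in>K. \<xi> k powi n k)" by auto
  have k: "k \<in> carrier G" using insert by simp
  have "\<xi> ((k [^] n k) \<otimes> y) = (\<Prod>k\<in>insert k K. \<xi> k powi n k)" if "\<xi> \<in> X" for \<xi>
  proof -
    have "\<xi> (k [^] n k) = \<xi> k powi n k"
      using that k is_group by (intro hom_circle_group_int_pow) (auto simp: characters_def)
    then show ?thesis
      using that k y insert.hyps by (simp add: char_mult)
  qed
  then show ?case using k y(1) by (intro bexI[of _ "(k [^] n k) \<otimes> y"]) auto
qed

lemma evaluation_in_bidual: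
  assumes "x \<in> carrier G"
  shows "evaluation G T x \<in> characters (dual_group G T) dual"
proof -
  have "continuous_map dual euclidean (evaluation G T x)"
    by (rule continuous_map_eq[OF continuous_map_dual_eval[of x]])
      (auto simp: assms topspace_T evaluation_def topspace_dual_topology)
  moreover have "\<phi> \<otimes>\<^bsub>dual_group G T\<^esub> \<psi> \<in> X" if "\<phi> \<in> X" "\<psi> \<in> X" for \<phi> \<psi>
    using monoid.m_closed[OF monoid_dual_group] that by (simp add: dual_group_def)
  ultimately show ?thesis
    using assms
    by (auto simp: characters_def[of "dual_group G T"] hom_circle_group_iff continuous_map_in_subtopology
        topspace_dual_topology evaluation_def char_norm)
      (auto simp: dual_group_def char_norm)
qed

text \<open>Continuity at the trivial character yields a finite \<open>K\<close> such that
  \<open>f\<close> is close to 1 on the characters close to 1 on \<open>K\<close>. Comfort-Ross,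
  applied to the dual with the evaluations at points of \<open>K\<close>, makes \<open>f\<close> a
  product of powers of evaluations.\<close>

lemma bidual_eq_evaluation:
  assumes "f \<in> characters (dual_group G T) dual"
  shows "\<exists>x\<in>carrier G. f = evaluation G T x"
proof -
  have carrier: "carrier (dual_group G T) = X" by (simp add: dual_group_def)
  interpret D: monoid "dual_group G T" by (rule monoid_dual_group)
  have f_norm: "norm (f \<xi>) = 1" if "\<xi> \<in> X" for \<xi>
    using assms that by (simp add: characters_def[of "dual_group G T"] hom_circle_group_iff carrier)
  have f_mult: "f (\<xi> \<otimes>\<^bsub>dual_group G T\<^esub> \<psi>) = f \<xi> * f \<psi>" if "\<xi> \<in> X" "\<psi> \<in> X" for \<xi> \<psi>
    using assms that by (simp add: characters_def[of "dual_group G T"] hom_circle_group_iff carrier)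
  have f_cont: "continuous_map dual euclidean f"
    using assms by (simp add: characters_def[of "dual_group G T"] continuous_map_in_subtopology)
  let ?id = "\<one>\<^bsub>dual_group G T\<^esub>"
  have one: "?id \<in> X" using D.one_closed carrier by simp
  have "f ?id = 1"
    using f_mult[OF one one] f_norm[OF one] D.one_closed by (auto simp: D.l_one)
  have "openin dual {\<xi> \<in> topspace dual. f \<xi> \<in> ball 1 (1/2)}"
    using f_cont by (rule openin_continuous_map_preimage) auto
  moreover have "?id \<in> {\<xi> \<in> topspace dual. f \<xi> \<in> ball 1 (1/2)}"
    using one \<open>f ?id = 1\<close> by (simp add: topspace_dual_topology)
  ultimately obtain K e where K: "compactin T K" "e > 0"
      "{\<psi> \<in> X. \<forall>x\<in>K. dist (\<psi> x) (?id x) < e} \<subseteq> {\<xi> \<in> topspace dual. f \<xi> \<in> ball 1 (1/2)}"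
    unfolding openin_dual_topology by blast
  have "finite K" using K(1) by (rule compactin_finite)
  have KG: "K \<subseteq> carrier G" using compactin_subset_topspace[OF K(1)] topspace_T by simp
  have "\<exists>n :: 'a \<Rightarrow> int. \<forall>\<xi>\<in>carrier (dual_group G T). f \<xi> = (\<Prod>k\<in>K. \<xi> k powi n k)"
  proof (rule character_eq_prod_powi[where x = "\<lambda>k \<xi>. \<xi> k"])
    fix \<xi> assume \<xi>: "\<xi> \<in> carrier (dual_group G T)" "\<And>k. k \<in> K \<Longrightarrow> norm (\<xi> k - 1) < e"
    then have "\<xi> \<in> {\<psi> \<in> X. \<forall>x\<in>K. dist (\<psi> x) (?id x) < e}"
      using KG by (auto simp: carrier dist_norm dual_group_def)
    then have "f \<xi> \<in> ball 1 (1/2)" using K(3) by blast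
    then show "norm (f \<xi> - 1) \<le> 1/2" by (simp add: dist_norm norm_minus_commute)
  next
    fix k \<phi> \<psi> assume "k \<in> K" 
    then show "(\<phi> \<otimes>\<^bsub>dual_group G T\<^esub> \<psi>) k = \<phi> k * \<psi> k"
      using KG by (auto simp: dual_group_def)
  qed (use \<open>finite K\<close> K(2) KG monoid_dual_group f_norm f_mult char_norm carrier in auto)
  then obtain n :: "'a \<Rightarrow> int" where n: "\<forall>\<xi>\<in>X. f \<xi> = (\<Prod>k\<in>K. \<xi> k powi n k)"
    using carrier by auto
  obtain y where y: "y \<in> carrier G" "\<forall>\<xi>\<in>X. \<xi> y = (\<Prod>k\<in>K. \<xi> k powi n k)"
    using prod_powi_chars[OF \<open>finite K\<close> KG] by blast
  have "f = evaluation G T y"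
    unfolding evaluation_def
    using assms n y by (intro extensionalityI[of _ X]) (auto simp: characters_def[of "dual_group G T"] carrier)
  then show ?thesis using y(1) by blast
qed

text \<open>Surjectivity is automatic by \<open>bidual_eq_evaluation\<close>. The first condition
  makes the evaluation map open and, as \<open>T\<close> is Hausdorff, injective; the second makes
  it continuous. Translations reduce both to the identity.\<close>

lemma reflexive_iff:
  "reflexive_group G T \<longleftrightarrow>
    (\<forall>U. openin T U \<and> \<one> \<in> U \<longrightarrow>
       (\<exists>K e. compactin dual K \<and> e > 0 \<and> {x \<in> carrier G. \<forall>\<xi>\<in>K. dist (\<xi> x) 1 < e} \<subseteq> U)) \<and>
    (\<forall>K. compactin dual K \<longrightarrow> (\<exists>U. openin T U \<and> \<one> \<in> U \<and> (\<forall>\<xi>\<in>K. \<forall>x\<in>U. \<xi> x = 1)))"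
  (is "_ \<longleftrightarrow> (\<forall>U. ?open U) \<and> (\<forall>K. ?cont K)")
proof
  let ?a = "evaluation G T" and ?DD = "dual_group (dual_group G T) dual"
    and ?tt = "dual_topology (dual_group G T) dual"
  have carrier: "carrier (dual_group G T) = X" by (simp add: dual_group_def)
  have carrier2: "carrier ?DD = characters (dual_group G T) dual" by (simp add: dual_group_def)
  have a_app: "?a x \<xi> = \<xi> x" if "\<xi> \<in> X" for x \<xi>
    using that by (simp add: evaluation_def)
  {
    assume "reflexive_group G T"
    then have iso: "?a \<in> iso G ?DD" and homeo: "homeomorphic_map T ?tt ?a"
      by (auto simp: reflexive_group_def)
    have inj: "inj_on ?a (carrier G)" using iso by (simp add: iso_def bij_betw_def)
    have "?open U" for U
    proof (intro impI, elim conjE)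
      assume U: "openin T U" "\<one> \<in> U"
      have UG: "U \<subseteq> carrier G" using U(1) openin_subset topspace_T by blast
      have "openin ?tt (?a ` U)"
        using homeo U(1) homeomorphic_imp_open_map open_map_def by blast
      then obtain K e where K: "compactin dual K" "e > 0"
          "{\<psi> \<in> characters (dual_group G T) dual. \<forall>\<xi>\<in>K. dist (\<psi> \<xi>) (?a \<one> \<xi>) < e} \<subseteq> ?a ` U"
        using U(2) unfolding openin_dual_topology[of _ dual] by blast
      have KX: "K \<subseteq> X" using compactin_subset_topspace[OF K(1)] topspace_dual_topology by blast
      have "x \<in> U" if x: "x \<in> carrier G" "\<forall>\<xi>\<in>K. dist (\<xi> x) 1 < e" for x
      proof -
        have "?a x \<in> ?a ` U"
          using x KX evaluation_in_bidual[OF x(1)]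
          by (intro subsetD[OF K(3)]) (auto simp: a_app char_one subset_iff)
        then show ?thesis using inj UG x(1) by (auto simp: inj_on_def)
      qed
      then show "\<exists>K e. compactin dual K \<and> e > 0 \<and> {x \<in> carrier G. \<forall>\<xi>\<in>K. dist (\<xi> x) 1 < e} \<subseteq> U"
        using K(1,2) by blast
    qed
    moreover have "?cont K" for K
    proof
      assume K: "compactin dual K"
      have KX: "K \<subseteq> X" using compactin_subset_topspace[OF K] topspace_dual_topology by blast
      \<comment> \<open>Continuity gives a neighbourhood for each radius \<open>1 / (n + 1)\<close>.
        Their countable intersection is still open, and there the characters in \<open>K\<close> are
        exactly 1.\<close>
      define V where "V = (\<lambda>n. {\<psi> \<in> characters (dual_group G T) dual.
          \<exists>d<inverse (real (Suc n)). \<forall>\<xi>\<in>K. dist (\<psi> \<xi>) (?a \<one> \<xi>) \<le> d})"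
      define U where "U = (\<lambda>n. {x \<in> topspace T. ?a x \<in> V n})"
      have "openin T (U n)" for n
        unfolding U_def V_def
        by (rule openin_continuous_map_preimage[OF homeomorphic_imp_continuous_map[OF homeo]])
          (rule openin_dual_nbhd[OF K])
      then have "openin T (\<Inter> (range U))"
        by (intro openin_countable_Inter) auto
      moreover have "\<one> \<in> \<Inter> (range U)"
        using evaluation_in_bidual[OF one_closed]
        by (auto simp: U_def V_def topspace_T intro!: exI[of _ 0])
      moreover have "\<xi> x = 1" if \<xi>: "\<xi> \<in> K" and x: "x \<in> \<Inter> (range U)" for \<xi> x
      proof -
        have "dist (\<xi> x) 1 < inverse (real (Suc n))" for n
        proof -
          have "x \<in> U n" using x by blast
          then obtain d where "d < inverse (real (Suc n))" "\<forall>\<xi>\<in>K. dist (?a x \<xi>) (?a \<one> \<xi>) \<le> d"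
            by (auto simp: U_def V_def)
          moreover have "\<xi> \<in> X" using \<xi> KX by blast
          ultimately show ?thesis using \<xi> by (force simp: a_app char_one)
        qed
        then have "dist (\<xi> x) 1 \<le> 0"
          by (metis reals_Archimedean not_le less_asym)
        then show ?thesis by simp
      qed
      ultimately show "\<exists>U. openin T U \<and> \<one> \<in> U \<and> (\<forall>\<xi>\<in>K. \<forall>x\<in>U. \<xi> x = 1)" by blast
    qed
    ultimately show "(\<forall>U. ?open U) \<and> (\<forall>K. ?cont K)" by blast
  }
  {
    assume *: "(\<forall>U. ?open U) \<and> (\<forall>K. ?cont K)"
    have bidual: "?a ` carrier G = characters (dual_group G T) dual"
      using evaluation_in_bidual bidual_eq_evaluation by blast
    \<comment> \<open>The complement of \<open>x\<close> is an open neighbourhood of the identity,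
      so the first condition yields a character that is not 1 at \<open>x\<close>.\<close>
    have sep: "\<exists>\<xi>\<in>X. \<xi> x \<noteq> 1" if x: "x \<in> carrier G" "x \<noteq> \<one>" for x
    proof -
      have "openin T (topspace T - {x})"
        using Hausdorff_T x topspace_T
        by (intro openin_diff openin_topspace closedin_Hausdorff_singleton) auto
      then obtain K e where K: "compactin dual K" "e > 0"
          "{y \<in> carrier G. \<forall>\<xi>\<in>K. dist (\<xi> y) 1 < e} \<subseteq> topspace T - {x}"
        using x spec[OF conjunct1[OF *], of "topspace T - {x}"] by (auto simp: topspace_T)
      then obtain \<xi> where "\<xi> \<in> K" "\<not> dist (\<xi> x) 1 < e" using x by blast
      moreover have "K \<subseteq> X" using compactin_subset_topspace[OF K(1)] topspace_dual_topology by blast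
      ultimately show ?thesis using K(2) by (intro bexI[of _ \<xi>]) auto
    qed
    have inj: "inj_on ?a (carrier G)"
    proof (rule inj_onI, rule ccontr)
      fix x y assume xy: "x \<in> carrier G" "y \<in> carrier G" "?a x = ?a y" "x \<noteq> y"
      have "x \<otimes> inv y \<noteq> \<one>" using xy inv_solve_right'[of \<one> x y] by simp
      then obtain \<xi> where \<xi>: "\<xi> \<in> X" "\<xi> (x \<otimes> inv y) \<noteq> 1"
        using sep[of "x \<otimes> inv y"] xy by auto
      have "\<xi> x = \<xi> y" using fun_cong[OF xy(3), of \<xi>] \<xi>(1) by (simp add: a_app)
      then show False using \<xi> xy char_nonzero[OF \<xi>(1) xy(2)] by (simp add: char_mult char_inv)
    qed
    have "?a \<in> hom G ?DD"
      using bidual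
      by (auto simp: hom_def carrier2 image_iff) (auto simp: dual_group_def[of "dual_group G T"] carrier evaluation_def char_mult)
    then have iso: "?a \<in> iso G ?DD"
      using inj bidual by (simp add: iso_def bij_betw_def carrier2)
    have cont: "continuous_map T ?tt ?a"
      unfolding continuous_map_def topspace_dual_topology
    proof (intro conjI allI impI)
      fix V assume V: "openin ?tt V"
      show "openin T {x \<in> topspace T. ?a x \<in> V}"
      proof (subst openin_subopen, clarify)
        fix x assume x: "x \<in> topspace T" "?a x \<in> V"
        then obtain K e where K: "compactin dual K" "e > 0"
            "{\<psi> \<in> characters (dual_group G T) dual. \<forall>\<xi>\<in>K. dist (\<psi> \<xi>) (?a x \<xi>) < e} \<subseteq> V"
          using V unfolding openin_dual_topology[of _ dual] by blast
        have KX: "K \<subseteq> X" using compactin_subset_topspace[OF K(1)] topspace_dual_topology by blast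
        obtain U where U: "openin T U" "\<one> \<in> U" "\<forall>\<xi>\<in>K. \<forall>x\<in>U. \<xi> x = 1"
          using spec[OF conjunct2[OF *], of K] K(1) by auto
        have xG: "x \<in> carrier G" using x topspace_T by simp
        let ?W = "{y \<in> topspace T. inv x \<otimes> y \<in> U}"
        have "openin T ?W"
          using xG U(1) by (intro openin_continuous_map_preimage[OF continuous_translation]) auto
        moreover have "x \<in> ?W" using x xG U(2) by simp
        moreover have "?W \<subseteq> {x \<in> topspace T. ?a x \<in> V}"
        proof
          fix y assume "y \<in> ?W"
          then have y: "y \<in> topspace T" "inv x \<otimes> y \<in> U" by auto
          then have yG: "y \<in> carrier G" using topspace_T by simp
          have eq: "\<xi> y = \<xi> x" if "\<xi> \<in> K" for \<xi>
          proof -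
            have \<xi>: "\<xi> \<in> X" using that KX by blast
            have "\<xi> (inv x \<otimes> y) = 1" using U(3) that y by blast
            then show ?thesis
              using \<xi> xG yG char_nonzero[OF \<xi> xG] by (simp add: char_mult char_inv field_simps)
          qed
          have "dist (?a y \<xi>) (?a x \<xi>) < e" if "\<xi> \<in> K" for \<xi>
            using eq[OF that] K(2) subsetD[OF KX that] by (simp add: a_app)
          then have "?a y \<in> V"
            using evaluation_in_bidual[OF yG] by (intro subsetD[OF K(3)]) auto
          then show "y \<in> {x \<in> topspace T. ?a x \<in> V}" using y by simp
        qed
        ultimately show "\<exists>W. openin T W \<and> x \<in> W \<and> W \<subseteq> {x \<in> topspace T. ?a x \<in> V}" by blast
      qed
    qed (use evaluation_in_bidual topspace_T in auto)
    have "open_map T ?tt ?a"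
      unfolding open_map_def
    proof (intro allI impI)
      fix U assume U: "openin T U"
      have UG: "U \<subseteq> carrier G" using openin_subset[OF U] topspace_T by simp
      show "openin ?tt (?a ` U)"
        unfolding openin_dual_topology[of _ dual]
      proof (intro conjI ballI)
        show "?a ` U \<subseteq> characters (dual_group G T) dual" using UG bidual by blast
        fix f assume "f \<in> ?a ` U"
        then obtain x where x: "x \<in> U" "f = ?a x" by blast
        then have xG: "x \<in> carrier G" using UG by blast
        let ?W = "{y \<in> topspace T. x \<otimes> y \<in> U}"
        have "openin T ?W"
          using xG U by (intro openin_continuous_map_preimage[OF continuous_translation]) auto
        moreover have "\<one> \<in> ?W" using x xG topspace_T by simp
        ultimately obtain K e where K: "compactin dual K" "e > 0"
            "{x \<in> carrier G. \<forall>\<xi>\<in>K. dist (\<xi> x) 1 < e} \<subseteq> ?W"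
          using spec[OF conjunct1[OF *], of ?W] by auto
        have KX: "K \<subseteq> X" using compactin_subset_topspace[OF K(1)] topspace_dual_topology by blast
        have "{\<psi> \<in> characters (dual_group G T) dual. \<forall>\<xi>\<in>K. dist (\<psi> \<xi>) (f \<xi>) < e} \<subseteq> ?a ` U"
        proof
          fix \<psi> assume "\<psi> \<in> {\<psi> \<in> characters (dual_group G T) dual. \<forall>\<xi>\<in>K. dist (\<psi> \<xi>) (f \<xi>) < e}"
          then have \<psi>: "\<psi> \<in> characters (dual_group G T) dual" "\<forall>\<xi>\<in>K. dist (\<psi> \<xi>) (f \<xi>) < e"
            by auto
          then obtain y where y: "y \<in> carrier G" "\<psi> = ?a y" using bidual by blast
          have "dist (\<xi> (inv x \<otimes> y)) 1 < e" if "\<xi> \<in> K" for \<xi>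
          proof -
            have \<xi>: "\<xi> \<in> X" using that KX by blast
            \<comment> \<open>Multiplication by \<open>inverse (\<xi> x)\<close>, a number of norm
              1, preserves distances.\<close>
            have "dist (\<xi> (inv x \<otimes> y)) 1 = norm (inverse (\<xi> x) * (\<xi> y - \<xi> x))"
              using \<xi> xG y(1) char_nonzero[OF \<xi> xG] by (simp add: char_mult char_inv dist_norm right_diff_distrib)
            also have "\<dots> = dist (\<xi> y) (\<xi> x)"
              using \<xi> xG by (simp add: norm_mult norm_inverse char_norm dist_norm)
            also have "\<dots> < e" using \<psi>(2) that y(2) x(2) \<xi> by (auto simp: a_app)
            finally show ?thesis .
          qed
          then have "inv x \<otimes> y \<in> ?W" using xG y(1) by (intro subsetD[OF K(3)]) auto
          then have "y \<in> U" using xG y(1) by (simp add: m_assoc[symmetric])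
          then show "\<psi> \<in> ?a ` U" using y(2) by blast
        qed
        then show "\<exists>K e. compactin dual K \<and> e > 0 \<and>
            {\<psi> \<in> characters (dual_group G T) dual. \<forall>\<xi>\<in>K. dist (\<psi> \<xi>) (f \<xi>) < e} \<subseteq> ?a ` U"
          using K(1,2) by blast
      qed
    qed
    then have "homeomorphic_map T ?tt ?a"
      using cont inj bidual by (intro bijective_open_imp_homeomorphic_map) (auto simp: topspace_T topspace_dual_topology)
    with iso show "reflexive_group G T" by (simp add: reflexive_group_def)
  }
qed

lemma reflexive_imp_open:
  assumes "reflexive_group G T" "openin T U" "\<one> \<in> U"
  shows "\<exists>K e. compactin dual K \<and> e > 0 \<and> {x \<in> carrier G. \<forall>\<xi>\<in>K. dist (\<xi> x) 1 < e} \<subseteq> U"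
  using spec[OF conjunct1[OF iffD1[OF reflexive_iff assms(1)]], of U] assms(2,3) by (rule mp[OF _ conjI])

lemma reflexive_imp_equicontinuous:
  assumes "reflexive_group G T" "compactin dual K"
  shows "\<exists>U. openin T U \<and> \<one> \<in> U \<and> (\<forall>\<xi>\<in>K. \<forall>x\<in>U. \<xi> x = 1)"
  using spec[OF conjunct2[OF iffD1[OF reflexive_iff assms(1)]], of K] assms(2) by (rule mp)

end

section \<open>Pulling back characters along continuous homomorphisms\<close>

lemma character_pullback:
  assumes "P_group G T" "P_group G' T'" "h \<in> hom G G'" "continuous_map T T' h" "\<psi> \<in> characters G' T'"
  shows "(\<lambda>x\<in>carrier G. \<psi> (h x)) \<in> characters G T"
proof -
  interpret G: P_group G T by fact
  interpret G': P_group G' T' by fact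
  have "continuous_map T euclidean (\<psi> \<circ> h)"
    using assms(4) G'.char_continuous[OF assms(5)] by (rule continuous_map_compose)
  then have "continuous_map T euclidean (\<lambda>x\<in>carrier G. \<psi> (h x))"
    by (rule continuous_map_eq) (simp add: G.topspace_T)
  then show ?thesis
    using assms(3,5) by (intro G.charI) (auto simp: hom_def Pi_iff G'.char_norm G'.char_mult)
qed

text \<open>Pulling back is continuous, because evaluating a pulled-back character at
  \<open>x\<close> means evaluating the original one at \<open>h x\<close>.\<close>

lemma compactin_pullback:
  assumes "P_group G T" "P_group G' T'" "h \<in> hom G G'" "continuous_map T T' h"
    and "compactin (dual_topology G' T') K"
  shows "compactin (dual_topology G T) ((\<lambda>\<psi>. \<lambda>x\<in>carrier G. \<psi> (h x)) ` K)"
proof -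
  interpret G: P_group G T by fact
  interpret G': P_group G' T' by fact
  have "continuous_map (dual_topology G' T') (dual_topology G T) (\<lambda>\<psi>. \<lambda>x\<in>carrier G. \<psi> (h x))"
  proof (rule G.continuous_map_into_dual)
    show "(\<lambda>\<psi>. \<lambda>x\<in>carrier G. \<psi> (h x)) \<in> topspace (dual_topology G' T') \<rightarrow> characters G T"
      using character_pullback[OF assms(1-4)] by (auto simp: topspace_dual_topology)
    show "continuous_map (dual_topology G' T') euclidean (\<lambda>\<psi>. (\<lambda>x\<in>carrier G. \<psi> (h x)) x)"
      if "x \<in> carrier G" for x
      using that assms(3) continuous_map_dual_eval[of "h x" T' G'] by (auto simp: hom_def G'.topspace_T)
  qed
  then show ?thesis using assms(5) by (intro image_compactin)
qed

subsection \<open>P-modifications of products\<close>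

lemma openin_P_modification_gdelta:
  "gdelta_in T S \<Longrightarrow> openin (P_modification T) S"
  by (simp add: openin_P_modification arbitrary_union_of_inc)

lemma openin_P_modification_iff:
  "openin (P_modification T) U \<longleftrightarrow> (\<forall>x\<in>U. \<exists>S. gdelta_in T S \<and> x \<in> S \<and> S \<subseteq> U)"
  unfolding openin_P_modification arbitrary_union_of_alt by blast

lemma openin_imp_openin_P_modification:
  "openin T U \<Longrightarrow> openin (P_modification T) U"
  by (simp add: openin_P_modification_gdelta open_imp_gdelta_in)

lemma gdelta_in_continuous_map_preimage:
  assumes "continuous_map T T' f" "gdelta_in T' S"
  shows "gdelta_in T {x \<in> topspace T. f x \<in> S}"
proof -
  obtain C :: "nat \<Rightarrow> _" where C: "\<And>n. openin T' (C n)" "\<And>n. C (Suc n) \<subseteq> C n" "\<Inter> (range C) = S"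
    using assms(2) unfolding gdelta_in_descending by auto
  define B where "B = (\<lambda>n. {x \<in> topspace T. f x \<in> C n})"
  have "openin T (B n)" "B (Suc n) \<subseteq> B n" for n
    using C(1,2) openin_continuous_map_preimage[OF assms(1)] by (auto simp: B_def)
  moreover have "\<Inter> (range B) = {x \<in> topspace T. f x \<in> S}"
    unfolding C(3)[symmetric] B_def by blast
  ultimately show ?thesis
    unfolding gdelta_in_descending by blast
qed

lemma continuous_map_P_modification:
  assumes "continuous_map T T' f"
  shows "continuous_map (P_modification T) (P_modification T') f"
  unfolding continuous_map_def topspace_P_modification
proof (intro conjI allI impI)
  show "f \<in> topspace T \<rightarrow> topspace T'" using assms by (simp add: continuous_map_def)
  fix U assume U: "openin (P_modification T') U"
  show "openin (P_modification T) {x \<in> topspace T. f x \<in> U}"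
    unfolding openin_P_modification_iff
  proof clarify
    fix x assume x: "x \<in> topspace T" "f x \<in> U"
    then obtain S where S: "gdelta_in T' S" "f x \<in> S" "S \<subseteq> U"
      using U unfolding openin_P_modification_iff by blast
    then show "\<exists>S. gdelta_in T S \<and> x \<in> S \<and> S \<subseteq> {x \<in> topspace T. f x \<in> U}"
      using x gdelta_in_continuous_map_preimage[OF assms S(1)] by blast
  qed
qed

text \<open>Around a given point each member contains a G-delta set, and countably many of these
  intersect in a G-delta set.\<close>

lemma openin_P_modification_Inter:
  assumes "countable \<U>" "\<U> \<noteq> {}" "\<And>U. U \<in> \<U> \<Longrightarrow> openin (P_modification T) U"
  shows "openin (P_modification T) (\<Inter>\<U>)"
  unfolding openin_P_modification_iff
proof
  fix x assume "x \<in> \<Inter>\<U>"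
  then have "\<forall>U\<in>\<U>. \<exists>S. gdelta_in T S \<and> x \<in> S \<and> S \<subseteq> U"
    using assms(3) unfolding openin_P_modification_iff by blast
  then obtain S where S: "\<forall>U\<in>\<U>. gdelta_in T (S U) \<and> x \<in> S U \<and> S U \<subseteq> U" by metis
  then have "gdelta_in T (\<Inter> (S ` \<U>))"
    using assms(1,2) by (intro gdelta_in_Inter) auto
  then show "\<exists>S. gdelta_in T S \<and> x \<in> S \<and> S \<subseteq> \<Inter>\<U>"
    using S by blast
qed

lemma Hausdorff_space_P_modification:
  assumes "Hausdorff_space T"
  shows "Hausdorff_space (P_modification T)"
  using assms unfolding Hausdorff_space_def topspace_P_modification
  by (metis openin_imp_openin_P_modification)

text \<open>A G-delta set around \<open>x\<close> contains a countable intersection of boxes around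
  \<open>x\<close>. Each box constrains finitely many coordinates; \<open>C\<close> collects them
  all, and \<open>V\<close> is the intersection of the boxes read over \<open>C\<close>.\<close>

lemma P_modification_product_nbhd:
  assumes U: "openin (P_modification (product_topology T J)) U" and x: "x \<in> U"
  shows "\<exists>C V. C \<subseteq> J \<and> countable C \<and> openin (P_modification (product_topology T C)) V \<and>
           restrict x C \<in> V \<and> {y \<in> topspace (product_topology T J). restrict y C \<in> V} \<subseteq> U"
proof -
  obtain S where S: "gdelta_in (product_topology T J) S" "x \<in> S" "S \<subseteq> U"
    using assms unfolding openin_P_modification_iff by blast
  then obtain W :: "nat \<Rightarrow> _" where W: "\<And>n. openin (product_topology T J) (W n)" "\<Inter> (range W) = S"
    unfolding gdelta_in_descending by auto
  have "\<exists>B. finite {i \<in> J. B i \<noteq> topspace (T i)} \<and> (\<forall>i\<in>J. openin (T i) (B i)) \<and>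
      x \<in> Pi\<^sub>E J B \<and> Pi\<^sub>E J B \<subseteq> W n" for n
    using W S(2) unfolding openin_product_topology_alt by blast
  then have "\<exists>B. \<forall>n. finite {i \<in> J. B n i \<noteq> topspace (T i)} \<and> (\<forall>i\<in>J. openin (T i) (B n i)) \<and>
      x \<in> Pi\<^sub>E J (B n) \<and> Pi\<^sub>E J (B n) \<subseteq> W n"
    by (intro choice allI)
  then obtain B where "\<forall>n. finite {i \<in> J. B n i \<noteq> topspace (T i)} \<and> (\<forall>i\<in>J. openin (T i) (B n i)) \<and>
      x \<in> Pi\<^sub>E J (B n) \<and> Pi\<^sub>E J (B n) \<subseteq> W n" ..
  then have B: "\<And>n. finite {i \<in> J. B n i \<noteq> topspace (T i)}" "\<And>n i. i \<in> J \<Longrightarrow> openin (T i) (B n i)"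
      "\<And>n. x \<in> Pi\<^sub>E J (B n)" "\<And>n. Pi\<^sub>E J (B n) \<subseteq> W n"
    by auto
  define C where "C = (\<Union>n. {i \<in> J. B n i \<noteq> topspace (T i)})"
  have CJ: "C \<subseteq> J" by (auto simp: C_def)
  have "countable C"
    unfolding C_def using B(1) by (intro countable_UN) (auto intro: countable_finite)
  define V where "V = (\<Inter>n. Pi\<^sub>E C (B n))"
  have "openin (product_topology T C) (Pi\<^sub>E C (B n))" for n
    unfolding openin_PiE_gen using B(1)[of n] B(2) CJ
    by (auto intro: finite_subset[of _ "{i \<in> J. B n i \<noteq> topspace (T i)}"])
  then have "openin (P_modification (product_topology T C)) V"
    unfolding V_def
    by (intro openin_P_modification_Inter) (auto intro: openin_imp_openin_P_modification)
  moreover have "restrict x C \<in> V"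
    using B(3) CJ by (auto simp: V_def PiE_iff)
  moreover have "y \<in> U" if y: "y \<in> topspace (product_topology T J)" "restrict y C \<in> V" for y
  proof -
    have "y \<in> Pi\<^sub>E J (B n)" for n
    proof (rule PiE_I)
      fix i assume i: "i \<in> J"
      show "y i \<in> B n i"
      proof (cases "i \<in> C")
        case True
        then show ?thesis using y(2) by (auto simp: V_def PiE_iff)
      next
        case False
        then have "B n i = topspace (T i)" using i by (auto simp: C_def)
        then show ?thesis using y(1) i by (auto simp: PiE_iff)
      qed
    next
      fix i assume "i \<notin> J"
      then show "y i = undefined" using y(1) by (auto simp: PiE_iff extensional_def)
    qed
    then have "y \<in> S" using B(4) W(2) by blast
    then show ?thesis using S(3) by blast
  qed
  ultimately show ?thesis
    using CJ \<open>countable C\<close> by blast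
qed

section \<open>Chains of countable sets of length omega_1\<close>

lemma countable_ordLeq_cardSuc_natLeq:
  assumes "countable C"
  shows "|C| \<le>o cardSuc natLeq"
  using assms ordLeq_transitive[OF _ cardSuc_ordLeq[OF natLeq_Card_order]]
  by (simp add: countable_card_le_natLeq)

text \<open>A chain of length \<open>\<omega>\<^sub>1\<close> of countable sets, each one witnessing that its predecessors fail,
  has a union \<open>J\<close> of size at most \<open>\<aleph>\<^sub>1\<close> that contradicts the reduction from \<open>J\<close> to a countable set,
  because \<open>\<omega>\<^sub>1\<close> is regular.\<close>

lemma countable_determined:
  fixes Z :: "'i set \<Rightarrow> 'b set"
  assumes mono: "\<And>A B. A \<subseteq> B \<Longrightarrow> B \<subseteq> I \<Longrightarrow> Z A \<subseteq> Z B"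
    and single: "\<And>k. k \<in> K \<Longrightarrow> \<exists>C\<subseteq>I. countable C \<and> k \<in> Z C"
    and reduce: "\<And>J. J \<subseteq> I \<Longrightarrow> |J| \<le>o cardSuc natLeq \<Longrightarrow> \<exists>C\<subseteq>J. countable C \<and> K \<inter> Z J \<subseteq> Z C"
  shows "\<exists>C\<subseteq>I. countable C \<and> K \<subseteq> Z C"
proof (rule ccontr)
  assume contr: "\<not> ?thesis"
  have "\<exists>C'\<subseteq>I. countable C' \<and> C \<subseteq> C' \<and> (\<exists>k\<in>K. k \<in> Z C' \<and> k \<notin> Z C)" if C: "C \<subseteq> I" "countable C" for C
  proof -
    obtain k where k: "k \<in> K" "k \<notin> Z C" using contr C by blast
    obtain D where "D \<subseteq> I" "countable D" "k \<in> Z D" using single[OF k(1)] by blast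
    then show ?thesis
      \<comment> \<open>\<open>D\<close> is a countable set that works for the element
        \<open>k\<close> on which \<open>C\<close> fails; by monotonicity
        \<open>C \<union> D\<close> works for \<open>k\<close> too.\<close>
      using C k mono[of D "C \<union> D"] by (intro exI[of _ "C \<union> D"]) auto
  qed
  then obtain s where s: "\<And>C. C \<subseteq> I \<Longrightarrow> countable C \<Longrightarrow>
      s C \<subseteq> I \<and> countable (s C) \<and> C \<subseteq> s C \<and> (\<exists>k\<in>K. k \<in> Z (s C) \<and> k \<notin> Z C)"
    by metis
  define r where "r = cardSuc natLeq"
  have r: "Card_order r" "\<not> finite (Field r)"
    unfolding r_def using natLeq_Card_order
    by (auto simp: cardSuc_Card_order cardSuc_finite Field_natLeq)
  have wo: "Well_order r" using r(1) by (simp add: card_order_on_def)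
  then have wf: "wf (r - Id)" and trans: "trans r"
    by (auto simp: well_order_on_def linear_order_on_def partial_order_on_def preorder_on_def)
  \<comment> \<open>Transfinite recursion along omega_1: stage \<open>a\<close> contains the
    enlargement \<open>s (A b)\<close> of every earlier stage, and so the witness against each of
    them.\<close>
  define A where "A = wfrec (r - Id) (\<lambda>f a. \<Union>b\<in>underS r a. s (f b))"
  have A: "A a = (\<Union>b\<in>underS r a. s (A b))" for a
    unfolding A_def
    by (subst wfrec[OF wf]) (auto simp: cut_apply underS_def)
  \<comment> \<open>Proper initial segments of omega_1 have size below the successor of aleph_0, so
    every stage is a countable union of countable sets.\<close>
  have count_underS: "countable (underS r a)" if "a \<in> Field r" for a
  proof -
    have "|underS r a| <o r" using r(1) that by (rule card_of_underS)
    then show ?thesis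
      unfolding r_def countable_card_le_natLeq
      using cardSuc_ordLeq_ordLess[OF natLeq_Card_order card_of_Card_order] by blast
  qed
  have A_props: "a \<in> Field r \<Longrightarrow> A a \<subseteq> I \<and> countable (A a)" for a
  proof (induction a rule: wf_induct_rule[OF wf])
    case (1 a)
    have "s (A b) \<subseteq> I \<and> countable (s (A b))" if "b \<in> underS r a" for b
    proof -
      have "(b, a) \<in> r - Id" "b \<in> Field r" using that by (auto simp: underS_def Field_def)
      then have "A b \<subseteq> I \<and> countable (A b)" by (rule 1(1))
      then show ?thesis using s[of "A b"] by blast
    qed
    then show ?case
      unfolding A[of a] using count_underS[OF 1(2)] by (intro conjI UN_least countable_UN) auto
  qed
  have "relChain r A"
    unfolding relChain_def
  proof clarify
    fix a b x assume ab: "(a, b) \<in> r" and x: "x \<in> A a"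
    have "underS r a \<subseteq> underS r b"
      using ab trans wo by (intro underS_incr) (auto simp: well_order_on_def linear_order_on_def partial_order_on_def)
    then show "x \<in> A b" using x A[of a] A[of b] by blast
  qed
  define J where "J = (\<Union>a\<in>Field r. A a)"
  have "J \<subseteq> I" using A_props by (auto simp: J_def)
  moreover have "|J| \<le>o cardSuc natLeq"
    unfolding J_def r_def[symmetric]
    using r A_props countable_ordLeq_cardSuc_natLeq
    by (intro card_of_UNION_ordLeq_infinite_Field) (auto simp: r_def card_of_Field_ordIso ordIso_imp_ordLeq)
  ultimately obtain C where C: "C \<subseteq> J" "countable C" "K \<inter> Z J \<subseteq> Z C"
    using reduce by blast
  \<comment> \<open>This is the regularity of omega_1: a countable subset of the union of the chain
    lies in one stage.\<close>
  have "\<exists>a\<in>Field (cardSuc natLeq). C \<subseteq> A a"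
  proof (rule cardSuc_UNION[OF natLeq_Card_order])
    show "infinite (Field natLeq)" by (simp add: Field_natLeq)
    show "relChain (cardSuc natLeq) A" using \<open>relChain r A\<close> by (simp add: r_def)
    show "C \<subseteq> (\<Union>i\<in>Field (cardSuc natLeq). A i)" using C(1) by (simp add: J_def r_def)
    show "|C| \<le>o natLeq" using C(2) by (simp add: countable_card_le_natLeq)
  qed
  then obtain a where a: "a \<in> Field r" "C \<subseteq> A a" by (auto simp: r_def)
  \<comment> \<open>An infinite cardinal has no last element; the later stage \<open>b\<close> puts
    \<open>s (A a)\<close>, and with it the witness \<open>k\<close> against \<open>A a\<close>,
    inside \<open>J\<close>.\<close>
  then obtain b where b: "b \<in> Field r" "a \<noteq> b" "(a, b) \<in> r"
    using infinite_Card_order_limit[OF r a(1)] by auto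
  have "s (A a) \<subseteq> A b" using b A[of b] by (auto simp: underS_def)
  then have sJ: "s (A a) \<subseteq> J" using b(1) by (auto simp: J_def)
  obtain k where k: "k \<in> K" "k \<in> Z (s (A a))" "k \<notin> Z (A a)"
    using s[of "A a"] A_props[OF a(1)] by auto
  have "k \<in> Z J" using mono[OF sJ \<open>J \<subseteq> I\<close>] k(2) by blast
  then have "k \<in> Z C" using C(3) k(1) by blast
  moreover have "A a \<subseteq> I" using A_props[OF a(1)] by simp
  ultimately show False using mono[OF a(2)] k(3) by blast
qed

subsection \<open>Projections of subgroups containing the sigma-product\<close>

lemma restrict_restrict_subset: "J \<subseteq> J' \<Longrightarrow> restrict (restrict x J') J = restrict x J"
  by (simp add: Int_absorb1 Int_absorb2)

locale P_product =
  fixes I :: "'i set" and D :: "'i \<Rightarrow> ('a, 'm) monoid_scheme"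
    and T :: "'i \<Rightarrow> 'a topology" and G :: "('i \<Rightarrow> 'a) set"
  assumes factor: "\<And>i. i \<in> I \<Longrightarrow> topological_abelian_group (D i) (T i)"
    and subgroup_G: "subgroup G (product_group I D)"
    and Sigma_G: "Sigma_product I D \<subseteq> G"
begin

abbreviation proj :: "'i set \<Rightarrow> ('i \<Rightarrow> 'a) set" where
  "proj J \<equiv> (\<lambda>x. restrict x J) ` G"

abbreviation PG :: "'i set \<Rightarrow> ('i \<Rightarrow> 'a) monoid" where
  "PG J \<equiv> (product_group J D)\<lparr>carrier := proj J\<rparr>"

abbreviation PT :: "'i set \<Rightarrow> ('i \<Rightarrow> 'a) topology" where
  "PT J \<equiv> subtopology (P_modification (product_topology T J)) (proj J)"

abbreviation chars :: "'i set \<Rightarrow> (('i \<Rightarrow> 'a) \<Rightarrow> complex) set" where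
  "chars J \<equiv> characters (PG J) (PT J)"

abbreviation dualT :: "'i set \<Rightarrow> (('i \<Rightarrow> 'a) \<Rightarrow> complex) topology" where
  "dualT J \<equiv> dual_topology (PG J) (PT J)"

text \<open>The argument may live on any \<open>J\<close> containing \<open>C\<close>, while the
  result always lives on \<open>I\<close> with support in \<open>C\<close>. Thus the same map serves
  as a retraction of \<open>G\<close> and as a lift from a projection.\<close>

definition ext :: "'i set \<Rightarrow> ('i \<Rightarrow> 'a) \<Rightarrow> 'i \<Rightarrow> 'a" where
  "ext C x = (\<lambda>i\<in>I. if i \<in> C then x i else \<one>\<^bsub>D i\<^esub>)"

lemma comm_group_factor: "i \<in> I \<Longrightarrow> comm_group (D i)"
  using factor by (simp add: topological_abelian_group_def)

lemma group_factor: "i \<in> I \<Longrightarrow> group (D i)"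
  using comm_group_factor by (simp add: comm_group_def)

lemma topspace_factor: "i \<in> I \<Longrightarrow> topspace (T i) = carrier (D i)"
  using factor by (simp add: topological_abelian_group_def)

lemma topspace_product: "J \<subseteq> I \<Longrightarrow> topspace (product_topology T J) = carrier (product_group J D)"
  using topspace_factor by (auto intro!: PiE_cong)

lemma G_PiE: "x \<in> G \<Longrightarrow> x \<in> (\<Pi>\<^sub>E i\<in>I. carrier (D i))"
  using subgroup.subset[OF subgroup_G] by auto

lemma G_component: "x \<in> G \<Longrightarrow> i \<in> I \<Longrightarrow> x i \<in> carrier (D i)"
  using G_PiE by (auto simp: PiE_iff)

lemma restrict_I: "x \<in> G \<Longrightarrow> restrict x I = x"
  using G_PiE by (auto simp: PiE_iff extensional_restrict)

lemma proj_I: "proj I = G"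
  using restrict_I by (auto simp: image_iff)

lemma proj_component: "J \<subseteq> I \<Longrightarrow> x \<in> proj J \<Longrightarrow> i \<in> J \<Longrightarrow> x i \<in> carrier (D i)"
  using G_component by auto

lemma proj_subset: "J \<subseteq> I \<Longrightarrow> proj J \<subseteq> carrier (product_group J D)"
  using G_component by auto

lemma comm_group_product:
  assumes "J \<subseteq> I"
  shows "comm_group (product_group J D)"
proof -
  have "group (product_group J D)" using assms group_factor by (intro product_group) auto
  then show ?thesis
  proof (rule group.group_comm_groupI)
    fix x y assume "x \<in> carrier (product_group J D)" "y \<in> carrier (product_group J D)"
    then show "x \<otimes>\<^bsub>product_group J D\<^esub> y = y \<otimes>\<^bsub>product_group J D\<^esub> x"
      using assms comm_group_factor
      by (auto simp: PiE_iff intro!: restrict_ext comm_monoid.m_comm[OF comm_group.axioms(1)])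
  qed
qed

lemma subgroup_proj:
  assumes "J \<subseteq> I"
  shows "subgroup (proj J) (product_group J D)"
proof -
  have "(\<lambda>x. restrict x J) \<in> hom (product_group I D) (product_group J D)"
    using assms by (auto simp: hom_def PiE_iff fun_eq_iff)
  then have "group_hom (product_group I D) (product_group J D) (\<lambda>x. restrict x J)"
    using comm_group_product[OF order_refl] comm_group_product[OF assms]
    by (simp add: group_hom_def group_hom_axioms_def comm_group_def)
  then show ?thesis
    by (rule group_hom.subgroup_img_is_subgroup[OF _ subgroup_G])
qed

lemma comm_group_PG:
  assumes "J \<subseteq> I"
  shows "comm_group (PG J)"
proof -
  interpret P: comm_group "product_group J D" by (rule comm_group_product[OF assms])
  have "group (PG J)" using subgroup_proj[OF assms] by (rule P.subgroup_imp_group)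
  then show ?thesis
  proof (rule group.group_comm_groupI)
    fix x y assume "x \<in> carrier (PG J)" "y \<in> carrier (PG J)"
    then have "x \<in> carrier (product_group J D)" "y \<in> carrier (product_group J D)"
      using proj_subset[OF assms] by auto
    then show "x \<otimes>\<^bsub>PG J\<^esub> y = y \<otimes>\<^bsub>PG J\<^esub> x"
      using P.m_comm by simp
  qed
qed

lemma PG_simps [simp]:
  "carrier (PG J) = proj J"
  "x \<otimes>\<^bsub>PG J\<^esub> y = (\<lambda>i\<in>J. x i \<otimes>\<^bsub>D i\<^esub> y i)"
  "\<one>\<^bsub>PG J\<^esub> = (\<lambda>i\<in>J. \<one>\<^bsub>D i\<^esub>)"
  by simp_all

lemma topspace_PT: "J \<subseteq> I \<Longrightarrow> topspace (PT J) = proj J"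
  using proj_subset[of J] topspace_product[of J]
  by (auto simp: topspace_P_modification simp del: topspace_product_topology carrier_product_group)

lemma continuous_map_PT:
  assumes "J \<subseteq> I" "J' \<subseteq> I" "h \<in> proj J \<rightarrow> proj J'"
    and "continuous_map (product_topology T J) (product_topology T J') h"
  shows "continuous_map (PT J) (PT J') h"
  using continuous_map_P_modification[OF assms(4)] assms(3)
  by (auto simp: continuous_map_in_subtopology continuous_map_from_subtopology topspace_PT[OF assms(1)])

lemma continuous_map_translation:
  assumes "i \<in> I" "a \<in> carrier (D i)"
  shows "continuous_map (T i) (T i) (\<lambda>x. a \<otimes>\<^bsub>D i\<^esub> x)"
proof -
  have "continuous_map (T i) (prod_topology (T i) (T i)) (\<lambda>x. (a, x))"
    using assms topspace_factor by (simp add: continuous_map_pairwise o_def)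
  moreover have "continuous_map (prod_topology (T i) (T i)) (T i) (\<lambda>(x, y). x \<otimes>\<^bsub>D i\<^esub> y)"
    using factor[OF assms(1)] by (simp add: topological_abelian_group_def)
  ultimately show ?thesis
    using continuous_map_compose by (fastforce simp: o_def)
qed

text \<open>Translations are continuous coordinatewise; countable intersections are formed in the
  P-modification of the product and then cut down to \<open>proj J\<close>.\<close>

lemma P_group_PG:
  assumes J: "J \<subseteq> I"
  shows "P_group (PG J) (PT J)"
proof -
  interpret C: comm_group "PG J" by (rule comm_group_PG[OF J])
  show ?thesis
  proof
    show "topspace (PT J) = carrier (PG J)" using topspace_PT[OF J] by simp
    have "Hausdorff_space (product_topology T J)"
      using J factor by (auto simp: Hausdorff_space_product_topology topological_abelian_group_def)
    then show "Hausdorff_space (PT J)"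
      by (intro Hausdorff_space_subtopology Hausdorff_space_P_modification)
  next
    fix a assume a: "a \<in> carrier (PG J)"
    have aD: "a i \<in> carrier (D i)" if "i \<in> J" for i
      using proj_component[OF J, of a i] a that by simp
    have "(\<lambda>x. a \<otimes>\<^bsub>PG J\<^esub> x) \<in> proj J \<rightarrow> proj J"
      using C.m_closed[OF a] by (simp only: PG_simps(1)) blast
    moreover have "continuous_map (product_topology T J) (product_topology T J) (\<lambda>x. a \<otimes>\<^bsub>PG J\<^esub> x)"
      unfolding continuous_map_componentwise
    proof (intro conjI ballI)
      fix i assume i: "i \<in> J"
      have "continuous_map (product_topology T J) (T i) ((\<lambda>x. a i \<otimes>\<^bsub>D i\<^esub> x) \<circ> (\<lambda>x. x i))"
        using i J aD[OF i]
        by (intro continuous_map_compose[where X' = "T i"] continuous_map_product_projection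
            continuous_map_translation) auto
      then show "continuous_map (product_topology T J) (T i) (\<lambda>x. (a \<otimes>\<^bsub>PG J\<^esub> x) i)"
        using i by (simp add: o_def)
    qed (auto simp: extensional_def)
    ultimately show "continuous_map (PT J) (PT J) (\<lambda>x. a \<otimes>\<^bsub>PG J\<^esub> x)"
      by (rule continuous_map_PT[OF J J])
  next
    fix \<U> assume \<U>: "countable \<U>" "\<U> \<noteq> {}" "\<And>U. U \<in> \<U> \<Longrightarrow> openin (PT J) U"
    then have "\<forall>U\<in>\<U>. \<exists>V. openin (P_modification (product_topology T J)) V \<and> U = V \<inter> proj J"
      by (simp add: openin_subtopology)
    then obtain V where V: "\<And>U. U \<in> \<U> \<Longrightarrow> openin (P_modification (product_topology T J)) (V U) \<and> U = V U \<inter> proj J"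
      by metis
    have "openin (P_modification (product_topology T J)) (\<Inter> (V ` \<U>))"
      using \<U> V by (intro openin_P_modification_Inter) auto
    moreover have "\<Inter>\<U> = \<Inter> (V ` \<U>) \<inter> proj J"
      using V \<U>(2) by blast
    ultimately show "openin (PT J) (\<Inter>\<U>)"
      unfolding openin_subtopology by blast
  qed
qed

lemma restrict_hom:
  assumes "J \<subseteq> J'" "J' \<subseteq> I"
  shows "(\<lambda>x. restrict x J) \<in> hom (PG J') (PG J)"
    and "continuous_map (PT J') (PT J) (\<lambda>x. restrict x J)"
proof -
  have closed: "(\<lambda>x. restrict x J) \<in> proj J' \<rightarrow> proj J"
    using assms(1) by (auto simp: restrict_restrict_subset simp del: restrict_restrict)
  moreover have "restrict (x \<otimes>\<^bsub>PG J'\<^esub> y) J = restrict x J \<otimes>\<^bsub>PG J\<^esub> restrict y J" for x y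
    using assms(1) by (auto simp: fun_eq_iff)
  ultimately show "(\<lambda>x. restrict x J) \<in> hom (PG J') (PG J)"
    unfolding hom_def PG_simps(1) by (intro CollectI conjI ballI)
  have "continuous_map (product_topology T J') (product_topology T J) (\<lambda>x. restrict x J)"
    using assms(1) by (auto simp: continuous_map_componentwise intro!: continuous_map_product_projection)
  with closed show "continuous_map (PT J') (PT J) (\<lambda>x. restrict x J)"
    using assms by (intro continuous_map_PT) auto
qed

text \<open>The inclusion of the sigma-product enters here: the support lies in the countable set
  \<open>C\<close>.\<close>

lemma ext_in_G:
  assumes "C \<subseteq> J" "J \<subseteq> I" "countable C" "x \<in> proj J"
  shows "ext C x \<in> G"
proof -
  have "supp I D (ext C x) \<subseteq> C" by (auto simp: supp_def ext_def)
  then have "countable (supp I D (ext C x))" using assms(3) countable_subset by blast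
  moreover have "ext C x \<in> carrier (product_group I D)"
    using assms proj_component[OF assms(2,4)] group_factor
    by (auto simp: ext_def group.is_monoid monoid.one_closed)
  ultimately show ?thesis using Sigma_G by (auto simp: Sigma_product_def)
qed

text \<open>Each coordinate of \<open>ext C\<close> is either a projection or constant, whence
  continuity.\<close>

lemma ext_hom:
  assumes "C \<subseteq> J" "J \<subseteq> I" "countable C"
  shows "ext C \<in> hom (PG J) (PG I)" and "continuous_map (PT J) (PT I) (ext C)"
proof -
  have closed: "ext C \<in> proj J \<rightarrow> proj I"
    using ext_in_G[OF assms] proj_I by auto
  moreover have "ext C (x \<otimes>\<^bsub>PG J\<^esub> y) = ext C x \<otimes>\<^bsub>PG I\<^esub> ext C y" for x y
    using assms(1) group_factor
    by (auto simp: ext_def group.is_monoid monoid.l_one monoid.one_closed intro!: restrict_ext)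
  ultimately show "ext C \<in> hom (PG J) (PG I)"
    unfolding hom_def PG_simps(1) by (intro CollectI conjI ballI)
  have "continuous_map (product_topology T J) (product_topology T I) (ext C)"
    unfolding continuous_map_componentwise
  proof (intro conjI ballI)
    fix i assume i: "i \<in> I"
    show "continuous_map (product_topology T J) (T i) (\<lambda>x. ext C x i)"
    proof (cases "i \<in> C")
      case True
      then show ?thesis
        using i assms(1) by (simp add: ext_def continuous_map_product_projection subsetD)
    next
      case False
      then show ?thesis
        using i group_factor by (simp add: ext_def topspace_factor group.is_monoid monoid.one_closed)
    qed
  qed (auto simp: ext_def)
  with closed show "continuous_map (PT J) (PT I) (ext C)"
    using assms by (intro continuous_map_PT) auto
qed

text \<open>\<open>P_modification_product_nbhd\<close> at the identity, cut down to the subgroups.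
  It reduces neighbourhood conditions to a countable \<open>C\<close>, where \<open>ext C\<close>
  has values in \<open>G\<close>.\<close>

lemma PT_nbhd:
  assumes J: "J \<subseteq> I" and U: "openin (PT J) U" "\<one>\<^bsub>PG J\<^esub> \<in> U"
  shows "\<exists>C V. C \<subseteq> J \<and> countable C \<and> openin (PT C) V \<and> \<one>\<^bsub>PG C\<^esub> \<in> V \<and>
           {y \<in> proj J. restrict y C \<in> V} \<subseteq> U"
proof -
  obtain U' where U': "openin (P_modification (product_topology T J)) U'" "U = U' \<inter> proj J"
    using U(1) unfolding openin_subtopology by blast
  then have "\<one>\<^bsub>PG J\<^esub> \<in> U'" using U(2) by blast
  from P_modification_product_nbhd[OF U'(1) this] obtain C V where
    C: "C \<subseteq> J" "countable C" and V: "openin (P_modification (product_topology T C)) V"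
      "restrict \<one>\<^bsub>PG J\<^esub> C \<in> V"
      "{y \<in> topspace (product_topology T J). restrict y C \<in> V} \<subseteq> U'"
    by blast
  have one: "restrict \<one>\<^bsub>PG J\<^esub> C = \<one>\<^bsub>PG C\<^esub>"
    using C(1) by (simp add: Int_absorb1)
  have "\<one>\<^bsub>PG C\<^esub> \<in> proj C"
    using subgroup.one_closed[OF subgroup_proj, of C] C(1) J by auto
  then have "openin (PT C) (V \<inter> proj C)" "\<one>\<^bsub>PG C\<^esub> \<in> V \<inter> proj C"
    using V(1,2) one by (auto simp: openin_subtopology)
  moreover have "{y \<in> proj J. restrict y C \<in> V \<inter> proj C} \<subseteq> U"
  proof
    fix y assume y: "y \<in> {y \<in> proj J. restrict y C \<in> V \<inter> proj C}"
    then have "y \<in> topspace (product_topology T J)"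
      using proj_subset[OF J] topspace_product[OF J] by blast
    then have "y \<in> U'" using V(3) y by blast
    then show "y \<in> U" using U'(2) y by blast
  qed
  ultimately show ?thesis using C by blast
qed

section \<open>Characters that factor through a set of coordinates\<close>

lemma topspace_PT_I: "topspace (PT I) = G"
  by (rule trans[OF topspace_PT proj_I]) simp

text \<open>The characters of \<open>G\<close> that factor through \<open>\<pi>\<^sub>J\<close>: being trivial on its kernel suffices by
  \<open>chars_over_factor\<close>.\<close>

definition chars_over :: "'i set \<Rightarrow> (('i \<Rightarrow> 'a) \<Rightarrow> complex) set" where
  "chars_over J = {\<xi> \<in> chars I. \<forall>x\<in>G. restrict x J = \<one>\<^bsub>PG J\<^esub> \<longrightarrow> \<xi> x = 1}"

lemma restrict_ext_restrict: "C \<subseteq> J \<Longrightarrow> ext C (restrict x J) = ext C x"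
  by (auto simp: ext_def fun_eq_iff)

lemma ext_restrict: "C \<subseteq> I \<Longrightarrow> restrict (ext C x) C = restrict x C"
  by (auto simp: ext_def fun_eq_iff)

lemma chars_over_mono:
  assumes "A \<subseteq> B" "B \<subseteq> I"
  shows "chars_over A \<subseteq> chars_over B"
proof -
  have "restrict x A = \<one>\<^bsub>PG A\<^esub>" if "restrict x B = \<one>\<^bsub>PG B\<^esub>" for x
  proof -
    have "restrict x A = restrict (restrict x B) A"
      using assms(1) by (rule restrict_restrict_subset[symmetric])
    also have "\<dots> = \<one>\<^bsub>PG A\<^esub>" using assms(1) by (simp only: that) (simp add: Int_absorb1)
    finally show ?thesis .
  qed
  then show ?thesis unfolding chars_over_def by blast
qed

text \<open>The quotient of \<open>x\<close> and \<open>y\<close> restricts to the identity on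
  \<open>J\<close>, so \<open>\<xi>\<close> is 1 there.\<close>

lemma chars_over_cong:
  assumes J: "J \<subseteq> I" and \<xi>: "\<xi> \<in> chars_over J" and xy: "x \<in> G" "y \<in> G" "restrict x J = restrict y J"
  shows "\<xi> x = \<xi> y"
proof -
  interpret I: P_group "PG I" "PT I" by (rule P_group_PG) simp
  interpret J: P_group "PG J" "PT J" by (rule P_group_PG[OF J])
  interpret R: group_hom "PG I" "PG J" "\<lambda>x. restrict x J"
    using restrict_hom(1)[OF J order_refl] by unfold_locales
  have xy': "x \<in> carrier (PG I)" "y \<in> carrier (PG I)" using xy proj_I by auto
  have "restrict (x \<otimes>\<^bsub>PG I\<^esub> inv\<^bsub>PG I\<^esub> y) J = restrict x J \<otimes>\<^bsub>PG J\<^esub> inv\<^bsub>PG J\<^esub> (restrict y J)"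
    using xy' by (simp only: R.hom_mult R.hom_inv I.inv_closed)
  also have "\<dots> = \<one>\<^bsub>PG J\<^esub>"
    unfolding xy(3) by (rule J.r_inv) (use xy in simp)
  finally have "\<xi> (x \<otimes>\<^bsub>PG I\<^esub> inv\<^bsub>PG I\<^esub> y) = 1"
    using \<xi> I.m_closed[OF xy'(1) I.inv_closed[OF xy'(2)]] proj_I unfolding chars_over_def PG_simps(1) by blast
  moreover have "\<xi> \<in> chars I" using \<xi> by (simp add: chars_over_def)
  ultimately have "\<xi> x * inverse (\<xi> y) = 1" "\<xi> y \<noteq> 0"
    using xy' I.char_nonzero by (simp_all only: I.char_mult I.char_inv I.inv_closed) simp
  then show ?thesis by (simp add: field_simps)
qed

text \<open>The kernel of a character is open, hence contains a neighbourhood of the identity that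
  depends on countably many coordinates.\<close>

lemma char_countable_support:
  assumes "\<xi> \<in> chars I"
  shows "\<exists>C\<subseteq>I. countable C \<and> \<xi> \<in> chars_over C"
proof -
  interpret I: P_group "PG I" "PT I" by (rule P_group_PG) simp
  obtain C V where C: "C \<subseteq> I" "countable C" "openin (PT C) V" "\<one>\<^bsub>PG C\<^esub> \<in> V"
      "{y \<in> proj I. restrict y C \<in> V} \<subseteq> {x \<in> carrier (PG I). \<xi> x = 1}"
    using PT_nbhd[OF order_refl I.openin_kernel[OF assms]] I.char_one[OF assms] I.one_closed by blast
  then have "\<xi> \<in> chars_over C"
    using assms proj_I unfolding chars_over_def by auto
  then show ?thesis using C by blast
qed

text \<open>Replacing \<open>x\<close> by \<open>ext C x\<close> does not change
  \<open>\<xi> x\<close>; if \<open>x\<close> is trivial on \<open>C \<inter> J\<close>, then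
  \<open>ext C x\<close> is trivial on all of \<open>J\<close>. Countability of \<open>C\<close>
  keeps \<open>ext C x\<close> in \<open>G\<close>.\<close>

lemma chars_over_Int:
  assumes "J \<subseteq> I" "C \<subseteq> I" "countable C" "\<xi> \<in> chars_over J" "\<xi> \<in> chars_over C"
  shows "\<xi> \<in> chars_over (C \<inter> J)"
proof -
  have "\<xi> x = 1" if x: "x \<in> G" "restrict x (C \<inter> J) = \<one>\<^bsub>PG (C \<inter> J)\<^esub>" for x
  proof -
    have extG: "ext C x \<in> G" using ext_in_G[of C I x] assms x(1) proj_I by auto
    then have "\<xi> x = \<xi> (ext C x)"
      using assms(2,5) x(1) by (intro chars_over_cong) (auto simp: ext_restrict)
    also have "restrict (ext C x) J = \<one>\<^bsub>PG J\<^esub>"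
    proof (rule ext)
      fix i show "restrict (ext C x) J i = \<one>\<^bsub>PG J\<^esub> i"
        using fun_cong[OF x(2), of i] assms(1) by (auto simp: ext_def split: if_splits)
    qed
    then have "\<xi> (ext C x) = 1" using assms(4) extG by (auto simp: chars_over_def)
    finally show ?thesis .
  qed
  then show ?thesis using assms(4) by (auto simp: chars_over_def)
qed

text \<open>The point is continuity on \<open>proj J\<close>. After shrinking \<open>J\<close> to a
  countable \<open>B\<close> on which \<open>\<xi>\<close> depends, the factor is the composition of
  \<open>\<xi>\<close> with the continuous homomorphism \<open>ext B\<close>.\<close>

lemma chars_over_factor:
  assumes J: "J \<subseteq> I" and \<xi>: "\<xi> \<in> chars_over J"
  shows "\<exists>\<psi>\<in>chars J. \<forall>x\<in>G. \<psi> (restrict x J) = \<xi> x"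
proof -
  have \<xi>I: "\<xi> \<in> chars I" using \<xi> by (simp add: chars_over_def)
  obtain C where C: "C \<subseteq> I" "countable C" "\<xi> \<in> chars_over C" using char_countable_support[OF \<xi>I] by blast
  define B where "B = C \<inter> J"
  have B: "B \<subseteq> J" "B \<subseteq> I" "countable B" "\<xi> \<in> chars_over B"
    using chars_over_Int[OF J C(1,2) \<xi> C(3)] C by (auto simp: B_def)
  define \<psi> where "\<psi> = (\<lambda>y\<in>carrier (PG J). \<xi> (ext B y))"
  have "\<psi> \<in> chars J"
    unfolding \<psi>_def
    by (rule character_pullback[OF P_group_PG[OF J] P_group_PG[OF order_refl] ext_hom[OF B(1) J B(3)] \<xi>I])
  moreover have "\<psi> (restrict x J) = \<xi> x" if x: "x \<in> G" for x
  proof -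
    have "\<psi> (restrict x J) = \<xi> (ext B x)"
      using x by (simp add: \<psi>_def restrict_ext_restrict[OF B(1)])
    also have "\<dots> = \<xi> x"
      using x B(2,4) ext_in_G[OF B(2) order_refl B(3), of x] proj_I
      by (intro chars_over_cong[OF B(2)]) (auto simp: ext_restrict)
    finally show ?thesis .
  qed
  ultimately show ?thesis by blast
qed

text \<open>The equations \<open>\<xi> x = 1\<close> define a closed set
  \<open>chars_over J\<close>. Factoring through the projection is continuous on it, since the
  factor at \<open>restrict x J\<close> takes the value \<open>\<xi> x\<close>; so compactness is
  passed on.\<close>

lemma compactin_factor:
  assumes J: "J \<subseteq> I" and K: "compactin (dualT I) K"
  shows "\<exists>K'. compactin (dualT J) K' \<and> (\<forall>\<xi>\<in>K \<inter> chars_over J. \<exists>\<psi>\<in>K'. \<forall>x\<in>G. \<psi> (restrict x J) = \<xi> x)"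
proof -
  interpret I: P_group "PG I" "PT I" by (rule P_group_PG) simp
  interpret J: P_group "PG J" "PT J" by (rule P_group_PG[OF J])
  define A where "A = {x \<in> G. restrict x J = \<one>\<^bsub>PG J\<^esub>}"
  have "closedin (dualT I) (topspace (dualT I) \<inter> (\<Inter>x\<in>A. {\<xi> \<in> topspace (dualT I). \<xi> x \<in> {1}}))"
  proof (cases "A = {}")
    case False
    have "closedin (dualT I) {\<xi> \<in> topspace (dualT I). \<xi> x \<in> {1}}" if "x \<in> A" for x
      using topspace_PT_I that
      by (intro closedin_continuous_map_preimage[OF continuous_map_dual_eval]) (auto simp: A_def)
    then show ?thesis
      using False by (intro closedin_Int closedin_topspace closedin_Inter) auto
  qed simp
  moreover have "topspace (dualT I) \<inter> (\<Inter>x\<in>A. {\<xi> \<in> topspace (dualT I). \<xi> x \<in> {1}}) = chars_over J"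
    by (auto simp: A_def chars_over_def topspace_dual_topology)
  ultimately have "closedin (dualT I) (chars_over J)" by simp
  then have comp: "compactin (dualT I) (chars_over J \<inter> K)" using K by (rule closed_Int_compactin)
  obtain \<sigma> where \<sigma>: "\<And>\<xi>. \<xi> \<in> chars_over J \<Longrightarrow> \<sigma> \<xi> \<in> chars J \<and> (\<forall>x\<in>G. \<sigma> \<xi> (restrict x J) = \<xi> x)"
    using chars_over_factor[OF J] by metis
  have "continuous_map (subtopology (dualT I) (chars_over J)) (dualT J) \<sigma>"
  proof (rule J.continuous_map_into_dual)
    show "\<sigma> \<in> topspace (subtopology (dualT I) (chars_over J)) \<rightarrow> chars J" using \<sigma> by auto
    fix y assume "y \<in> carrier (PG J)"
    then obtain x where x: "x \<in> G" "y = restrict x J" by auto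
    have "continuous_map (subtopology (dualT I) (chars_over J)) euclidean (\<lambda>\<xi>. \<xi> x)"
      using x(1) by (intro continuous_map_from_subtopology continuous_map_dual_eval) (simp only: topspace_PT_I)
    then show "continuous_map (subtopology (dualT I) (chars_over J)) euclidean (\<lambda>\<xi>. \<sigma> \<xi> y)"
      by (rule continuous_map_eq) (use x \<sigma> in auto)
  qed
  moreover have "compactin (subtopology (dualT I) (chars_over J)) (chars_over J \<inter> K)"
    using comp by (simp add: compactin_subtopology)
  ultimately have "compactin (dualT J) (\<sigma> ` (chars_over J \<inter> K))" by (intro image_compactin)
  then show ?thesis using \<sigma> by (intro exI[of _ "\<sigma> ` (chars_over J \<inter> K)"]) auto
qed

section \<open>Transfer of reflexivity between \<open>G\<close> and its projections\<close>

text \<open>Both conditions of \<open>reflexive_iff\<close> travel through \<open>G\<close>: compact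
  sets of characters of \<open>G\<close> are pulled back along \<open>ext C\<close>, those of the
  projection along the restriction to \<open>J\<close>. The argument is the same for
  \<open>J\<close> of any size.\<close>

lemma reflexive_imp_reflexive_proj:
  assumes J: "J \<subseteq> I" and refl: "reflexive_group (PG I) (PT I)"
  shows "reflexive_group (PG J) (PT J)"
proof -
  interpret I: P_group "PG I" "PT I" by (rule P_group_PG) simp
  interpret J: P_group "PG J" "PT J" by (rule P_group_PG[OF J])
  show ?thesis
    unfolding J.reflexive_iff
  proof (intro conjI allI impI, elim conjE)
    fix U assume "openin (PT J) U" "\<one>\<^bsub>PG J\<^esub> \<in> U"
    from PT_nbhd[OF J this] obtain C V where C: "C \<subseteq> J" "countable C"
      and V: "openin (PT C) V" "\<one>\<^bsub>PG C\<^esub> \<in> V" "{y \<in> proj J. restrict y C \<in> V} \<subseteq> U"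
      by blast
    have CI: "C \<subseteq> I" using C J by blast
    define N where "N = {x \<in> topspace (PT I). restrict x C \<in> V}"
    have "openin (PT I) N"
      unfolding N_def by (rule openin_continuous_map_preimage[OF restrict_hom(2)[OF CI order_refl] V(1)])
    moreover have "restrict \<one>\<^bsub>PG I\<^esub> C = \<one>\<^bsub>PG C\<^esub>"
      using CI by (simp add: Int_absorb1)
    then have "\<one>\<^bsub>PG I\<^esub> \<in> N"
      using V(2) I.one_closed by (simp only: N_def I.topspace_T mem_Collect_eq)
    ultimately obtain K e where K: "compactin (dualT I) K" "e > 0"
        "{x \<in> carrier (PG I). \<forall>\<xi>\<in>K. dist (\<xi> x) 1 < e} \<subseteq> N"
      using I.reflexive_imp_open[OF refl] by blast
    define K' where "K' = (\<lambda>\<psi>. \<lambda>x\<in>carrier (PG J). \<psi> (ext C x)) ` K"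
    have "compactin (dualT J) K'"
      unfolding K'_def
      by (rule compactin_pullback[OF P_group_PG[OF J] P_group_PG[OF order_refl] ext_hom[OF C(1) J C(2)] K(1)])
    moreover have "{y \<in> carrier (PG J). \<forall>\<xi>\<in>K'. dist (\<xi> y) 1 < e} \<subseteq> U"
    proof
      fix y assume y: "y \<in> {y \<in> carrier (PG J). \<forall>\<xi>\<in>K'. dist (\<xi> y) 1 < e}"
      then have yJ: "y \<in> proj J" by simp
      have "ext C y \<in> carrier (PG I)" using ext_in_G[OF C(1) J C(2) yJ] proj_I by simp
      moreover have "\<forall>\<xi>\<in>K. dist (\<xi> (ext C y)) 1 < e" using y by (auto simp: K'_def)
      ultimately have "ext C y \<in> N" using K(3) by blast
      then have "restrict y C \<in> V" using ext_restrict[OF CI] by (simp add: N_def)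
      then show "y \<in> U" using V(3) yJ by blast
    qed
    ultimately show "\<exists>K e. compactin (dualT J) K \<and> e > 0 \<and> {y \<in> carrier (PG J). \<forall>\<xi>\<in>K. dist (\<xi> y) 1 < e} \<subseteq> U"
      using K(2) by blast
  next
    fix K' assume K': "compactin (dualT J) K'"
    define pull where "pull = (\<lambda>\<psi> :: _ \<Rightarrow> complex. \<lambda>x\<in>carrier (PG I). \<psi> (restrict x J))"
    have "compactin (dualT I) (pull ` K')"
      unfolding pull_def
      by (rule compactin_pullback[OF P_group_PG[OF order_refl] P_group_PG[OF J] restrict_hom[OF J order_refl] K'])
    then obtain U where U: "openin (PT I) U" "\<one>\<^bsub>PG I\<^esub> \<in> U" "\<forall>\<xi>\<in>pull ` K'. \<forall>x\<in>U. \<xi> x = 1"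
      using I.reflexive_imp_equicontinuous[OF refl] by blast
    from PT_nbhd[OF order_refl U(1,2)] obtain C V where C: "C \<subseteq> I" "countable C"
      and V: "openin (PT C) V" "\<one>\<^bsub>PG C\<^esub> \<in> V" "{y \<in> proj I. restrict y C \<in> V} \<subseteq> U"
      by blast
    \<comment> \<open>The set \<open>C\<close> found in \<open>G\<close> may leave \<open>J\<close>;
      only \<open>C \<inter> J\<close> gives a map \<open>ext B\<close> on
      \<open>proj J\<close>.\<close>
    define B where "B = C \<inter> J"
    have B: "B \<subseteq> J" "countable B" using C(2) by (auto simp: B_def)
    define U' where "U' = {y \<in> topspace (PT J). ext B y \<in> U}"
    have "openin (PT J) U'"
      unfolding U'_def by (rule openin_continuous_map_preimage[OF ext_hom(2)[OF B(1) J B(2)] U(1)])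
    moreover have "ext B \<one>\<^bsub>PG J\<^esub> = \<one>\<^bsub>PG I\<^esub>"
      using B(1) by (auto simp: ext_def fun_eq_iff)
    then have "\<one>\<^bsub>PG J\<^esub> \<in> U'"
      using U(2) J.one_closed by (simp only: U'_def J.topspace_T mem_Collect_eq)
    moreover have "\<psi> y = 1" if \<psi>: "\<psi> \<in> K'" and y: "y \<in> U'" for \<psi> y
    proof -
      have "y \<in> proj J" using y unfolding U'_def J.topspace_T PG_simps(1) by blast
      then obtain x where x: "x \<in> G" "y = restrict x J" by blast
      have \<psi>X: "\<psi> \<in> chars J" using \<psi> compactin_subset_topspace[OF K'] by (auto simp: topspace_dual_topology)
      have pull: "pull \<psi> \<in> chars I"
        unfolding pull_def
        by (rule character_pullback[OF P_group_PG[OF order_refl] P_group_PG[OF J] restrict_hom[OF J order_refl] \<psi>X])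
      \<comment> \<open>Elements of \<open>G\<close> that are trivial on \<open>C\<close> lie in
        \<open>U\<close>, because \<open>V\<close> contains the identity.\<close>
      then have "pull \<psi> \<in> chars_over C"
        using U(3) V(2,3) \<psi> proj_I unfolding chars_over_def by auto
      moreover have "ext C x \<in> G" using ext_in_G[of C I x] C x(1) proj_I by simp
      ultimately have "pull \<psi> x = pull \<psi> (ext C x)"
        using x(1) by (intro chars_over_cong[OF C(1)]) (auto simp: ext_restrict[OF C(1)])
      also have "\<dots> = \<psi> (restrict (ext C x) J)"
        using \<open>ext C x \<in> G\<close> proj_I by (simp add: pull_def)
      \<comment> \<open>On \<open>C \<inter> J\<close> both sides agree with \<open>x\<close>, on
        the rest of \<open>J\<close> both are the identity.\<close>
      also have "restrict (ext C x) J = restrict (ext B y) J"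
        using J x(2) by (auto simp: ext_def B_def fun_eq_iff)
      also have extB: "ext B y \<in> G" using ext_in_G[OF B(1) J B(2)] \<open>y \<in> proj J\<close> .
      then have "\<psi> (restrict (ext B y) J) = pull \<psi> (ext B y)"
        using proj_I by (simp add: pull_def)
      also have "\<dots> = 1" using U(3) \<psi> y by (auto simp: U'_def)
      finally show ?thesis using x proj_I by (simp add: pull_def)
    qed
    ultimately show "\<exists>U. openin (PT J) U \<and> \<one>\<^bsub>PG J\<^esub> \<in> U \<and> (\<forall>\<psi>\<in>K'. \<forall>y\<in>U. \<psi> y = 1)" by blast
  qed
qed

text \<open>\<open>compactin_factor\<close> moves the part of \<open>K\<close> living over
  \<open>J\<close> to the projection, whose reflexivity provides \<open>U\<close>. It serves twice:
  for sets of size at most aleph_1 in the chain argument, and for the countable set obtained from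
  it.\<close>

lemma compactin_equicontinuous_factor:
  assumes J: "J \<subseteq> I" and refl: "reflexive_group (PG J) (PT J)" and K: "compactin (dualT I) K"
  shows "\<exists>U. openin (PT J) U \<and> \<one>\<^bsub>PG J\<^esub> \<in> U \<and> (\<forall>\<xi>\<in>K \<inter> chars_over J. \<forall>x\<in>G. restrict x J \<in> U \<longrightarrow> \<xi> x = 1)"
proof -
  interpret J: P_group "PG J" "PT J" by (rule P_group_PG[OF J])
  obtain K' where K': "compactin (dualT J) K'" "\<forall>\<xi>\<in>K \<inter> chars_over J. \<exists>\<psi>\<in>K'. \<forall>x\<in>G. \<psi> (restrict x J) = \<xi> x"
    using compactin_factor[OF J K] by blast
  obtain U where U: "openin (PT J) U" "\<one>\<^bsub>PG J\<^esub> \<in> U" "\<forall>\<psi>\<in>K'. \<forall>x\<in>U. \<psi> x = 1"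
    using J.reflexive_imp_equicontinuous[OF refl K'(1)] by blast
  have "\<xi> x = 1" if \<xi>: "\<xi> \<in> K \<inter> chars_over J" and x: "x \<in> G" "restrict x J \<in> U" for \<xi> x
  proof -
    obtain \<psi> where \<psi>: "\<psi> \<in> K'" "\<forall>x\<in>G. \<psi> (restrict x J) = \<xi> x"
      using bspec[OF K'(2) \<xi>] by (rule bexE)
    then show ?thesis
      using bspec[OF \<psi>(2) x(1)] bspec[OF bspec[OF U(3) \<psi>(1)] x(2)] by simp
  qed
  then show ?thesis using U(1,2) by blast
qed

text \<open>Neighbourhoods reduce to a countable projection at once. For a compact \<open>K\<close>
  of characters, \<open>countable_determined\<close> with \<open>chars_over\<close> as
  \<open>Z\<close> first finds a countable \<open>C\<close> over which all of \<open>K\<close>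
  lives.\<close>

lemma reflexive_if_reflexive_proj:
  assumes refl: "\<And>J. J \<subseteq> I \<Longrightarrow> |J| \<le>o cardSuc natLeq \<Longrightarrow> reflexive_group (PG J) (PT J)"
  shows "reflexive_group (PG I) (PT I)"
proof -
  interpret I: P_group "PG I" "PT I" by (rule P_group_PG) simp
  have refl_countable: "reflexive_group (PG C) (PT C)" if "C \<subseteq> I" "countable C" for C
    using that refl countable_ordLeq_cardSuc_natLeq by blast
  have restrict_one: "restrict \<one>\<^bsub>PG I\<^esub> C = \<one>\<^bsub>PG C\<^esub>" if "C \<subseteq> I" for C
    using that by (simp add: Int_absorb1)
  show ?thesis
    unfolding I.reflexive_iff
  proof (intro conjI allI impI, elim conjE)
    fix U assume "openin (PT I) U" "\<one>\<^bsub>PG I\<^esub> \<in> U"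
    from PT_nbhd[OF order_refl this] obtain C V where C: "C \<subseteq> I" "countable C"
      and V: "openin (PT C) V" "\<one>\<^bsub>PG C\<^esub> \<in> V" "{y \<in> proj I. restrict y C \<in> V} \<subseteq> U"
      by blast
    interpret C: P_group "PG C" "PT C" by (rule P_group_PG[OF C(1)])
    obtain K e where K: "compactin (dualT C) K" "e > 0" "{y \<in> carrier (PG C). \<forall>\<psi>\<in>K. dist (\<psi> y) 1 < e} \<subseteq> V"
      using C.reflexive_imp_open[OF refl_countable[OF C] V(1,2)] by blast
    define K' where "K' = (\<lambda>\<psi>. \<lambda>x\<in>carrier (PG I). \<psi> (restrict x C)) ` K"
    have "compactin (dualT I) K'"
      unfolding K'_def
      by (rule compactin_pullback[OF P_group_PG[OF order_refl] P_group_PG[OF C(1)] restrict_hom[OF C(1) order_refl] K(1)])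
    moreover have "{x \<in> carrier (PG I). \<forall>\<xi>\<in>K'. dist (\<xi> x) 1 < e} \<subseteq> U"
    proof
      fix x assume x: "x \<in> {x \<in> carrier (PG I). \<forall>\<xi>\<in>K'. dist (\<xi> x) 1 < e}"
      then have xI: "x \<in> proj I" "x \<in> G" using proj_I by auto
      have "\<forall>\<psi>\<in>K. dist (\<psi> (restrict x C)) 1 < e" using x by (auto simp: K'_def)
      then have "restrict x C \<in> V" using K(3) xI(2) by auto
      then show "x \<in> U" using V(3) xI(1) by blast
    qed
    ultimately show "\<exists>K e. compactin (dualT I) K \<and> e > 0 \<and> {x \<in> carrier (PG I). \<forall>\<xi>\<in>K. dist (\<xi> x) 1 < e} \<subseteq> U"
      using K(2) by blast
  next
    fix K assume K: "compactin (dualT I) K"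
    have "\<exists>C\<subseteq>I. countable C \<and> K \<subseteq> chars_over C"
    proof (rule countable_determined)
      show "chars_over A \<subseteq> chars_over B" if "A \<subseteq> B" "B \<subseteq> I" for A B using that by (rule chars_over_mono)
      show "\<exists>C\<subseteq>I. countable C \<and> \<xi> \<in> chars_over C" if "\<xi> \<in> K" for \<xi>
        using that compactin_subset_topspace[OF K]
        by (intro char_countable_support) (auto simp: topspace_dual_topology)
      fix J assume J: "J \<subseteq> I" "|J| \<le>o cardSuc natLeq"
      obtain U where U: "openin (PT J) U" "\<one>\<^bsub>PG J\<^esub> \<in> U"
          "\<forall>\<xi>\<in>K \<inter> chars_over J. \<forall>x\<in>G. restrict x J \<in> U \<longrightarrow> \<xi> x = 1"
        using compactin_equicontinuous_factor[OF J(1) refl[OF J] K] by blast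
      from PT_nbhd[OF J(1) U(1,2)] obtain C V where C: "C \<subseteq> J" "countable C"
        and V: "openin (PT C) V" "\<one>\<^bsub>PG C\<^esub> \<in> V" "{y \<in> proj J. restrict y C \<in> V} \<subseteq> U"
        by blast
      \<comment> \<open>If \<open>x\<close> is trivial on \<open>C\<close>, then its restriction to
        \<open>J\<close> lies in \<open>U\<close>, where these characters are 1; hence they live
        over the countable set \<open>C\<close>.\<close>
      have "\<xi> x = 1" if \<xi>: "\<xi> \<in> K \<inter> chars_over J" and x: "x \<in> G" "restrict x C = \<one>\<^bsub>PG C\<^esub>" for \<xi> x
      proof -
        have "restrict (restrict x J) C \<in> V"
          unfolding restrict_restrict_subset[OF C(1)] using x(2) V(2) by (simp only:)
        then have "restrict x J \<in> U" using V(3) x(1) by blast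
        then show ?thesis using U(3) \<xi> x(1) by blast
      qed
      then have "K \<inter> chars_over J \<subseteq> chars_over C"
        unfolding chars_over_def[of C] using chars_over_def[of J] by blast
      then show "\<exists>C\<subseteq>J. countable C \<and> K \<inter> chars_over J \<subseteq> chars_over C" using C by blast
    qed
    then obtain C where C: "C \<subseteq> I" "countable C" "K \<subseteq> chars_over C" by blast
    \<comment> \<open>Now \<open>K \<inter> chars_over C\<close> is all of \<open>K\<close>, so
      reflexivity of the projection to \<open>C\<close> handles every character in \<open>K\<close>
      at once.\<close>
    obtain V where V: "openin (PT C) V" "\<one>\<^bsub>PG C\<^esub> \<in> V"
        "\<forall>\<xi>\<in>K \<inter> chars_over C. \<forall>x\<in>G. restrict x C \<in> V \<longrightarrow> \<xi> x = 1"
      using compactin_equicontinuous_factor[OF C(1) refl_countable[OF C(1,2)] K] by blast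
    define U where "U = {x \<in> topspace (PT I). restrict x C \<in> V}"
    have "openin (PT I) U"
      unfolding U_def by (rule openin_continuous_map_preimage[OF restrict_hom(2)[OF C(1) order_refl] V(1)])
    moreover have "\<one>\<^bsub>PG I\<^esub> \<in> U"
      unfolding U_def I.topspace_T mem_Collect_eq restrict_one[OF C(1)] using I.one_closed V(2) by (rule conjI)
    moreover have "\<forall>\<xi>\<in>K. \<forall>x\<in>U. \<xi> x = 1"
    proof (intro ballI)
      fix \<xi> x assume "\<xi> \<in> K" "x \<in> U"
      moreover from this have "x \<in> G" unfolding U_def topspace_PT_I by blast
      ultimately show "\<xi> x = 1" using V(3) C(3) by (auto simp: U_def)
    qed
    ultimately show "\<exists>U. openin (PT I) U \<and> \<one>\<^bsub>PG I\<^esub> \<in> U \<and> (\<forall>\<xi>\<in>K. \<forall>x\<in>U. \<xi> x = 1)" by blast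
  qed
qed

end

theorem theorem5:
  fixes I :: "'i set"
    and D :: "'i \<Rightarrow> ('a, 'm) monoid_scheme"
    and T :: "'i \<Rightarrow> 'a topology"
    and G :: "('i \<Rightarrow> 'a) set"
  assumes "\<And>i. i \<in> I \<Longrightarrow> topological_abelian_group (D i) (T i)"
    and "subgroup G (product_group I D)"
    and "Sigma_product I D \<subseteq> G"
  shows "reflexive_group ((product_group I D)\<lparr>carrier := G\<rparr>)
           (subtopology (P_modification (product_topology T I)) G) \<longleftrightarrow>
         (\<forall>J \<subseteq> I. |J| \<le>o cardSuc natLeq \<longrightarrow>
           reflexive_group
             ((product_group J D)\<lparr>carrier := (\<lambda>x. restrict x J) ` G\<rparr>)
             (subtopology (P_modification (product_topology T J)) ((\<lambda>x. restrict x J) ` G)))"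
proof -
  interpret P_product I D T G using assms by (rule P_product.intro)
  show ?thesis
    using reflexive_imp_reflexive_proj reflexive_if_reflexive_proj unfolding proj_I by blast
qed

end
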